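(* Let $\mathfrak{A}$ be a real normed division algebra, i.e. $\mathfrak{A}=\mathbb{R},\mathbb{C},\mathbb{H}$ or $\mathbb{O}$, of real dimension $\beta=1,2,4$ or $8$ respectively, and let $n\ge m\ge 1$ be integers. Let $\rho>0$, $k\in\mathbb{R}$ and $\nu$ with $\mathrm{Re}(\nu\beta/2)>-k$, let $\tau=(t_1,\dots,t_m)\in\mathbb{R}^m$ with $\mathrm{Re}(n\beta/2)>(m-1)\beta/2-t_m$, let $\boldsymbol{\Sigma}\in\mathfrak{P}_m^{\beta}$, $\boldsymbol{\Theta}\in\mathfrak{P}_n^{\beta}$, and let $\boldsymbol{\mu}\in\mathfrak{L}_{n,m}^{\beta}$ be a constant matrix. Let $S=(S^{1/2})^2$ have the one-dimensional Riesz type I distribution $\mathcal{R}_1^{\beta,I}(\nu\beta/2,k,\rho)$, and let $\mathbf{Y}$ be a random $n\times m$ matrix over $\mathfrak{A}$, independent of $S$, with the Kotz-Riesz type I distribution $\mathcal{KR}^{\beta,I}_{n\times m}(\tau,\mathbf{0},\boldsymbol{\Theta},\boldsymbol{\Sigma})$. Define $\mathbf{T}=S^{-1/2}\mathbf{Y}+\boldsymbol{\mu}$. Then the density of $\mathbf{T}$ with respect to Lebesgue measure $(d\mathbf{T})$ on $\mathfrak{A}^{n\times m}$ is $$ c\,\left[1+\rho\,\mathrm{tr}\,\boldsymbol{\Sigma}^{-1}(\mathbf{T}-\boldsymbol{\mu})^{*}\boldsymbol{\Theta}^{-1}(\mathbf{T}-\boldsymbol{\mu})\right]^{-\left[(\nu+mn)\beta/2+k+\sum_{i=1}^m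 t_i\right]}\; q_{\tau}\!\left(\mathcal{U}(\boldsymbol{\Sigma})^{*-1}(\mathbf{T}-\boldsymbol{\mu})^{*}\boldsymbol{\Theta}^{-1}(\mathbf{T}-\boldsymbol{\mu})\,\mathcal{U}(\boldsymbol{\Sigma})^{-1}\right), $$ where $$ c=\frac{\Gamma_m^{\beta}[n\beta/2]\;\Gamma_1^{\beta}\!\left[(\nu+mn)\beta/2+k+\sum_{i=1}^m t_i\right]\;\rho^{\beta mn/2+\sum_{i=1}^m t_i}}{\pi^{\beta mn/2}\;\Gamma_m^{\beta}[n\beta/2,\tau]\;\Gamma_1^{\beta}[\nu\beta/2+k]\;|\boldsymbol{\Sigma}|^{\beta n/2}\,|\boldsymbol{\Theta}|^{\beta m/2}}. $$ This law is termed the matrix multivariate $T$-Riesz type I distribution.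
   Context: Notation. $\mathfrak{A}$ is one of the four real normed division algebras: $\mathbb{R}$, $\mathbb{C}$, $\mathbb{H}$ (quaternions), $\mathbb{O}$ (octonions), of real dimension $\beta=1,2,4,8$. (The authors include the octonions, but remark that the veracity of the results in that case can in general only be conjectured, while asserting validity for the Albert algebra, i.e. when the Hermitian matrices are $3\times3$ octonionic.) $\mathfrak{A}^{n\times m}$ is the space of $n\times m$ matrices over $\mathfrak{A}$, identified with $\mathbb{R}^{\beta nm}$ by real components of the entries and given the corresponding Lebesgue measure. $\mathbf{A}^*$ is the conjugate transpose. $\mathfrak{L}^{\beta}_{n,m}$ is the set of $n\times m$ matrices over $\mathfrak{A}$ of rank $m\le n$ with $m$ distinct positive singular values. $\mathfrak{P}_m^{\beta}$ is the cone of positive definite Hermitian $m\times m$ matrices over $\mathfrak{A}$. $|\cdot|$ is the determinant of a Hermitian matrix (product of the eigenvalues). $\mathrm{tr}$ denotes the (real part of the) trace, and $\mathrm{etr}(\cdot)=\exp(\mathrm{tr}(\cdot))$. For $\mathbf{B}\in\mathfrak{P}_m^\beta$, $\mathcal{U}(\mathbf{B})$ is the upper triangular matrix with positive diagonal such that $\mathbf{B}=\mathcal{U}(\mathbf{B})^*\mathcal{U}(\mathbf{B})$ (Cholesky decomposition). Generalised power (highest weight vector). For $\kappa=(k_1,\dots,k_m)\in\mathbb{R}^m$, $q_\kappa(\mathbf{A})=|\mathbf{A}_m|^{k_m}\prod_{i=1}^{m-1}|\mathbf{A}_i|^{k_i-k_{i+1}}$, where $\mathbf{A}_p$ is the leading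 principal $p\times p$ submatrix of $\mathbf{A}$. Gamma functions. $\Gamma_m^\beta[a]=\pi^{m(m-1)\beta/4}\prod_{i=1}^m\Gamma[a-(i-1)\beta/2]$ and $\Gamma_m^\beta[a,\kappa]=\pi^{m(m-1)\beta/4}\prod_{i=1}^m\Gamma[a+k_i-(i-1)\beta/2]$, where $\Gamma=\Gamma_1^\beta$ is the ordinary gamma function. Riesz type I distribution in dimension one. $S\sim\mathcal{R}_1^{\beta,I}(a,k,\rho)$ means that $S$ has density on $(0,\infty)$ $$\frac{\beta^{a+k}}{\Gamma[a+k]\,\rho^{a+k}}\,e^{-\beta s/\rho}\,s^{a+k-1}.$$ Kotz-Riesz type I distribution. $\mathbf{Y}\sim\mathcal{KR}^{\beta,I}_{n\times m}(\kappa,\boldsymbol{\mu},\boldsymbol{\Theta},\boldsymbol{\Sigma})$ means that $\mathbf{Y}$ has density with respect to Lebesgue measure on $\mathfrak{A}^{n\times m}$ $$\frac{\beta^{mn\beta/2+\sum_i k_i}\,\Gamma_m^\beta[n\beta/2]}{\pi^{mn\beta/2}\,\Gamma_m^\beta[n\beta/2,\kappa]\,|\boldsymbol{\Sigma}|^{n\beta/2}|\boldsymbol{\Theta}|^{m\beta/2}}\,\mathrm{etr}\{-\beta\,\boldsymbol{\Sigma}^{-1}(\mathbf{Y}-\boldsymbol{\mu})^*\boldsymbol{\Theta}^{-1}(\mathbf{Y}-\boldsymbol{\mu})\}\; q_\kappa\!\left[\mathcal{U}(\boldsymbol{\Sigma})^{*-1}(\mathbf{Y}-\boldsymbol{\mu})^*\boldsymbol{\Theta}^{-1}(\mathbf{Y}-\boldsymbol{\mu})\,\mathcal{U}(\boldsymbol{\Sigma})^{-1}\right],$$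 with $\mathrm{Re}(n\beta/2)>(m-1)\beta/2-k_m$. *)

theory Defs
  imports "HOL-Probability.Probability"
begin

section \<open>Real normed division algebras\<close>

text \<open>
  A real normed division algebra is a finite-dimensional Euclidean space with a bilinear, unital,
  not necessarily commutative or associative product such that \<open>\<bar>xy\<bar> = \<bar>x\<bar> \<bar>y\<bar>\<close>.  By Hurwitz' theorem
  these are, up to isometric isomorphism, the reals, the complex numbers, the quaternions and the
  octonions (all four are instances, see below), and \<open>\<beta>\<close> is the dimension.  The library class
  \<^class>\<open>real_normed_div_algebra\<close> is not used because it demands associativity.
\<close>

class hurwitz_algebra = euclidean_space + times + one +
  assumes hz_add_left: "(x + y) * z = x * z + y * z"
    and hz_add_right: "x * (y + z) = x * y + x * z"
    and hz_scaleR_left: "(r *\<^sub>R x) * y = r *\<^sub>R (x * y)"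
    and hz_scaleR_right: "x * (r *\<^sub>R y) = r *\<^sub>R (x * y)"
    and hz_one_left: "1 * x = x"
    and hz_one_right: "x * 1 = x"
    and hz_norm_mult: "norm (x * y) = norm x * norm y"

class hurwitz_algebra_assoc = hurwitz_algebra +
  assumes hz_assoc: "(x * y) * z = x * (y * z)"

class hurwitz_algebra_comm = hurwitz_algebra_assoc +
  assumes hz_comm: "x * y = y * x"

definition hRe :: "'a::hurwitz_algebra \<Rightarrow> real"
  where "hRe x = inner x 1"

text \<open>Conjugation is the reflection in the real line \<open>\<real>1\<close>; on \<^typ>\<open>complex\<close> it is \<^const>\<open>cnj\<close>.\<close>

definition hcnj :: "'a::{euclidean_space, one} \<Rightarrow> 'a"
  where "hcnj x = (2 * inner x 1) *\<^sub>R 1 - x"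

lemma hz_zero_left [simp]: "0 * (x::'a::hurwitz_algebra) = 0"
  using hz_scaleR_left[of 0 x x] hz_scaleR_left[of 0 0 x] by simp

lemma hz_zero_right [simp]: "(x::'a::hurwitz_algebra) * 0 = 0"
  using hz_scaleR_right[of x 0 0] by simp

lemma hz_minus_left: "(- x) * y = - (x * (y::'a::hurwitz_algebra))"
  using hz_scaleR_left[of "-1" x y] by simp

lemma hz_minus_right: "x * (- y) = - (x * (y::'a::hurwitz_algebra))"
  using hz_scaleR_right[of x "-1" y] by simp

lemma hz_diff_left: "(x - y) * z = x * z - y * (z::'a::hurwitz_algebra)"
  using hz_add_left[of x "-y" z] by (simp add: hz_minus_left)

lemma hz_diff_right: "x * (y - z) = x * y - x * (z::'a::hurwitz_algebra)"
  using hz_add_right[of x y "-z"] by (simp add: hz_minus_right)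

lemma hz_one_ne_0: "(1::'a::hurwitz_algebra) \<noteq> 0"
  by (metis ex_in_conv hz_one_left hz_zero_left nonempty_Basis nonzero_Basis)

lemma hz_norm_1: "norm (1::'a::hurwitz_algebra) = 1"
  using hz_norm_mult[of 1 "1::'a"] hz_one_ne_0[where 'a='a] by (simp add: hz_one_left)

lemma hz_inner_1: "inner 1 (1::'a::hurwitz_algebra) = 1"
  by (simp add: dot_square_norm hz_norm_1)

lemma hcnj_add: "hcnj (x + y) = hcnj x + hcnj (y::'a::hurwitz_algebra)"
  by (simp add: hcnj_def algebra_simps inner_add_left)

lemma hcnj_diff: "hcnj (x - y) = hcnj x - hcnj (y::'a::hurwitz_algebra)"
  by (simp add: hcnj_def algebra_simps inner_diff_left)

lemma hcnj_scaleR: "hcnj (r *\<^sub>R x) = r *\<^sub>R hcnj (x::'a::hurwitz_algebra)"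
  by (simp add: hcnj_def algebra_simps)

lemma hcnj_hcnj [simp]: "hcnj (hcnj x) = (x::'a::hurwitz_algebra)"
  by (simp add: hcnj_def inner_diff_left hz_inner_1 algebra_simps)

lemma hcnj_1 [simp]: "hcnj 1 = (1::'a::hurwitz_algebra)"
  by (simp add: hcnj_def hz_inner_1 scaleR_2)

lemma hcnj_0 [simp]: "hcnj 0 = (0::'a::hurwitz_algebra)"
  by (simp add: hcnj_def)

lemma hcnj_inner: "inner (hcnj x) (hcnj y) = inner x (y::'a::hurwitz_algebra)"
  by (simp add: hcnj_def inner_diff_left inner_diff_right hz_inner_1 inner_commute algebra_simps)

lemma hcnj_norm: "norm (hcnj x) = norm (x::'a::hurwitz_algebra)"
  by (simp add: norm_eq_sqrt_inner hcnj_inner)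

lemma hz_inner_left: "inner (x * y) (x * z) = inner x x * inner y (z::'a::hurwitz_algebra)"
proof -
  have *: "inner (x * u) (x * u) = inner x x * inner u u" for u :: 'a
    by (simp add: dot_square_norm hz_norm_mult power_mult_distrib)
  show ?thesis
    using *[of "y + z"] *[of y] *[of z]
    by (simp add: hz_add_right inner_add_left inner_add_right inner_commute[of "x*z" "x*y"]
        inner_commute[of z y] distrib_left)
qed

lemma hz_inner_right: "inner (y * x) (z * x) = inner x x * inner y (z::'a::hurwitz_algebra)"
proof -
  have *: "inner (u * x) (u * x) = inner x x * inner u u" for u :: 'a
    by (simp add: dot_square_norm hz_norm_mult power_mult_distrib mult.commute)
  show ?thesis
    using *[of "y + z"] *[of y] *[of z]
    by (simp add: hz_add_left inner_add_left inner_add_right inner_commute[of "z*x" "y*x"]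
        inner_commute[of z y] distrib_left)
qed

lemma hz_adjoint_left: "inner (x * y) z = inner y (hcnj x * (z::'a::hurwitz_algebra))"
  using hz_inner_left[of "x + 1" y z] hz_inner_left[of x y z]
  by (simp add: hcnj_def hz_add_left hz_diff_left hz_scaleR_left hz_one_left inner_add_left
      inner_add_right inner_diff_right hz_inner_1 inner_commute[of 1 x] algebra_simps)

lemma hz_adjoint_right: "inner (y * x) z = inner y ((z::'a::hurwitz_algebra) * hcnj x)"
  using hz_inner_right[of y "x + 1" z] hz_inner_right[of y x z]
  by (simp add: hcnj_def hz_add_right hz_diff_right hz_scaleR_right hz_one_right inner_add_left
      inner_add_right inner_diff_right hz_inner_1 inner_commute[of 1 x] algebra_simps)

lemma hcnj_mult: "hcnj (x * y) = hcnj y * hcnj (x::'a::hurwitz_algebra)"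
proof -
  have "inner (hcnj (x * y)) z = inner (hcnj y * hcnj x) z" for z
  proof -
    have "inner (hcnj (x * y)) z = inner (x * y) (hcnj z)"
      using hcnj_inner[of "x * y" "hcnj z"] by simp
    also have "\<dots> = inner (y * z) (hcnj x)"
      using hz_adjoint_left[of x y "hcnj z"] hz_adjoint_right[of y z "hcnj x"] by simp
    also have "\<dots> = inner (hcnj y * hcnj x) z"
      using hz_adjoint_left[of y z "hcnj x"] by (metis inner_commute)
    finally show ?thesis .
  qed
  then show ?thesis
    by (metis inner_eq_zero_iff inner_diff_left right_minus_eq)
qed

lemma hcnj_mult_self: "hcnj x * x = (inner x x) *\<^sub>R (1::'a::hurwitz_algebra)"
proof -
  have "inner (hcnj x * x) z = inner (inner x x *\<^sub>R 1) z" for z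
    using hz_adjoint_left[of "hcnj x" x z] hz_inner_left[of x 1 z] by (simp add: hz_one_right)
  then show ?thesis
    by (metis inner_eq_zero_iff inner_diff_left right_minus_eq)
qed

instance real :: hurwitz_algebra_comm
  by standard (auto simp: algebra_simps abs_mult)

instance complex :: hurwitz_algebra_comm
  by standard (auto simp: algebra_simps norm_mult)

text \<open>Quaternions and octonions, by Cayley--Dickson doubling.\<close>

datatype 'a cd = CD (cd1: 'a) (cd2: 'a)

instantiation cd :: (real_vector) real_vector
begin
definition "0 = CD 0 0"
definition "x + y = CD (cd1 x + cd1 y) (cd2 x + cd2 y)"
definition "- x = CD (- cd1 x) (- cd2 x)"
definition "x - y = CD (cd1 x - cd1 y) (cd2 x - cd2 y)"
definition "r *\<^sub>R x = CD (r *\<^sub>R cd1 x) (r *\<^sub>R cd2 x)"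
instance
  by standard (auto simp: zero_cd_def plus_cd_def uminus_cd_def minus_cd_def scaleR_cd_def
      algebra_simps)
end

instantiation cd :: (real_inner) real_inner
begin
definition "inner x y = inner (cd1 x) (cd1 y) + inner (cd2 x) (cd2 y)"
definition "norm (x::'a cd) = sqrt (inner x x)"
definition "sgn (x::'a cd) = x /\<^sub>R norm x"
definition "dist x (y::'a cd) = norm (x - y)"
definition
  "(uniformity :: ('a cd \<times> 'a cd) filter) = (INF e\<in>{0 <..}. principal {(x, y). dist x y < e})"
definition
  "open (U :: 'a cd set) \<longleftrightarrow> (\<forall>x\<in>U. eventually (\<lambda>(x', y). x' = x \<longrightarrow> y \<in> U) uniformity)"
instance
proof
  fix x y z :: "'a cd" and r :: real
  show "inner x y = inner y x" "inner (x + y) z = inner x z + inner y z"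
    "inner (r *\<^sub>R x) y = r * inner x y" "0 \<le> inner x x"
    by (auto simp: inner_cd_def plus_cd_def scaleR_cd_def inner_commute algebra_simps inner_add_left)
  show "inner x x = 0 \<longleftrightarrow> x = 0"
    by (cases x) (auto simp: inner_cd_def zero_cd_def add_nonneg_eq_0_iff)
qed (rule norm_cd_def sgn_cd_def dist_cd_def uniformity_cd_def open_cd_def)+
end

instantiation cd :: (euclidean_space) euclidean_space
begin
definition "Basis = (\<lambda>u. CD u 0) ` Basis \<union> (\<lambda>v. CD 0 v) ` Basis"
instance
proof
  show "(Basis :: 'a cd set) \<noteq> {}" "finite (Basis :: 'a cd set)"
    by (auto simp: Basis_cd_def)
  fix u v :: "'a cd"
  assume "u \<in> Basis" "v \<in> Basis"
  then show "inner u v = (if u = v then 1 else 0)"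
    by (auto simp: Basis_cd_def inner_cd_def inner_Basis split: if_split_asm)
next
  fix x :: "'a cd"
  show "(\<forall>u\<in>Basis. inner x u = 0) \<longleftrightarrow> x = 0"
    by (cases x) (simp add: Basis_cd_def inner_cd_def zero_cd_def ball_Un euclidean_all_zero_iff)
qed
end

lemma DIM_cd [simp]: "DIM('a::euclidean_space cd) = 2 * DIM('a)"
  unfolding Basis_cd_def
  by (subst card_Un_disjoint) (auto simp: card_image inj_on_def)

instantiation cd :: ("{euclidean_space, one}") one
begin
definition "1 = CD 1 0"
instance ..
end

instantiation cd :: ("{euclidean_space, times, one}") times
begin
definition "x * y = CD (cd1 x * cd1 y - hcnj (cd2 y) * cd2 x) (cd2 y * cd1 x + cd2 x * hcnj (cd1 y))"
instance ..
end

lemma hcnj_cd: "hcnj (CD a b) = CD (hcnj a) (- b)"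
  by (simp add: hcnj_def one_cd_def inner_cd_def minus_cd_def scaleR_cd_def)

instance cd :: (hurwitz_algebra_assoc) hurwitz_algebra
proof
  fix x y z :: "'a cd" and r :: real
  show "(x + y) * z = x * z + y * z" "x * (y + z) = x * y + x * z"
    by (auto simp: plus_cd_def times_cd_def hz_add_left hz_add_right hcnj_add)
  show "(r *\<^sub>R x) * y = r *\<^sub>R (x * y)" "x * (r *\<^sub>R y) = r *\<^sub>R (x * y)"
    by (auto simp: scaleR_cd_def times_cd_def hz_scaleR_left hz_scaleR_right hcnj_scaleR
        algebra_simps)
  show "1 * x = x" "x * 1 = x"
    by (auto simp: one_cd_def times_cd_def hz_one_left hz_one_right)
  obtain a b where x: "x = CD a b" by (cases x)
  obtain c d where y: "y = CD c d" by (cases y)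
  have cross: "inner (a * c) (hcnj d * b) = inner (d * a) (b * hcnj c)"
    by (metis hcnj_hcnj hz_adjoint_left hz_adjoint_right hz_assoc)
  have n: "inner (u * v) (u * v) = inner u u * inner v v" for u v :: 'a
    by (simp add: dot_square_norm hz_norm_mult power_mult_distrib)
  have "inner (x * y) (x * y) = inner x x * inner y y"
    by (simp add: x y times_cd_def inner_cd_def inner_add_left inner_add_right inner_diff_left
        inner_diff_right n cross hcnj_inner inner_commute[of "hcnj d * b" "a * c"]
        inner_commute[of "b * hcnj c" "d * a"] algebra_simps)
  then show "norm (x * y) = norm x * norm y"
    by (simp add: norm_cd_def real_sqrt_mult)
qed

instance cd :: (hurwitz_algebra_comm) hurwitz_algebra_assoc
proof
  fix x y z :: "'a cd"
  have lc: "u * (v * w) = v * (u * w)" for u v w :: 'a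
    by (metis hz_assoc hz_comm)
  show "(x * y) * z = x * (y * z)"
    by (simp add: times_cd_def hz_add_left hz_add_right hz_diff_left hz_diff_right hcnj_add
        hcnj_diff hcnj_mult hz_assoc lc hz_comm algebra_simps)
qed

type_synonym quaternion = "complex cd"
type_synonym octonion = "quaternion cd"

lemma "DIM(real) = 1" "DIM(complex) = 2" "DIM(quaternion) = 4" "DIM(octonion) = 8"
  by simp_all


section \<open>Matrices\<close>

text \<open>
  \<^const>\<open>matrix_matrix_mult\<close> requires an associative ring, so the product is repeated here.
  Matrices are vectors of rows: \<^typ>\<open>'a^'m^'n\<close> has \<open>n\<close> rows and \<open>m\<close> columns.
\<close>

definition mmul :: "'a::hurwitz_algebra^'k^'n \<Rightarrow> 'a^'m^'k \<Rightarrow> 'a^'m^'n"  (infixl "\<odot>" 70)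
  where "A \<odot> B = (\<chi> i j. \<Sum>k\<in>UNIV. A $ i $ k * B $ k $ j)"

definition madj :: "'a::hurwitz_algebra^'m^'n \<Rightarrow> 'a^'n^'m"
  where "madj A = (\<chi> i j. hcnj (A $ j $ i))"

definition hermitian :: "'a::hurwitz_algebra^'m^'m \<Rightarrow> bool"
  where "hermitian A \<longleftrightarrow> madj A = A"

definition rtr :: "'a::hurwitz_algebra^'m^'m \<Rightarrow> real"
  where "rtr A = (\<Sum>i\<in>UNIV. hRe (A $ i $ i))"

text \<open>
  \<open>P\<^sup>* W P\<close>, as the mean of the two bracketings.  They agree when \<open>'a\<close> is associative (see
  \<open>mcong_assoc\<close>); for octonions each is the adjoint of the other when \<open>W\<close> is Hermitian, and the
  mean is the choice that is Hermitian.
\<close>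

definition mcong :: "'a::hurwitz_algebra^'m^'n \<Rightarrow> 'a^'n^'n \<Rightarrow> 'a^'m^'m"
  where "mcong P W = (1/2) *\<^sub>R ((madj P \<odot> W) \<odot> P + madj P \<odot> (W \<odot> P))"

definition jprod :: "'a::hurwitz_algebra^'m^'m \<Rightarrow> 'a^'m^'m \<Rightarrow> 'a^'m^'m"
  where "jprod A B = (1/2) *\<^sub>R (A \<odot> B + B \<odot> A)"

text \<open>
  Inverse of a general square matrix, as in \<^const>\<open>matrix_inv\<close>; used for triangular matrices.
\<close>

definition minv :: "'a::hurwitz_algebra^'m^'m \<Rightarrow> 'a^'m^'m"
  where "minv A = (THE B. A \<odot> B = mat 1 \<and> B \<odot> A = mat 1)"

text \<open>
  Inverse of a Hermitian matrix, in the Jordan sense: this is the inverse in the Albert algebra,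
  where \<open>A \<odot> B = mat 1\<close> is in general not solvable by a Hermitian \<open>B\<close>.  Over an associative
  algebra it is the ordinary inverse (see \<open>hinv_assoc\<close>).
\<close>

definition hinv :: "'a::hurwitz_algebra^'m^'m \<Rightarrow> 'a^'m^'m"
  where "hinv A = (THE B. hermitian B \<and> jprod A B = mat 1 \<and> jprod (A \<odot> A) B = A)"

text \<open>
  Positive definiteness of the quadratic form \<open>X \<mapsto> Re tr (X A X)\<close> on Hermitian matrices \<open>X\<close>.  Over
  an associative algebra this says \<open>x\<^sup>* A x > 0\<close> for all column vectors \<open>x \<noteq> 0\<close> (see
  \<open>pos_def_assoc\<close>); for \<open>3 \<times> 3\<close> octonionic matrices it defines the symmetric cone of the Albert
  algebra, whereas \<open>Re (x\<^sup>* A x) > 0\<close> for all octonionic columns \<open>x \<noteq> 0\<close> would be strictly stronger.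
\<close>

definition pos_def :: "'a::hurwitz_algebra^'m^'m \<Rightarrow> bool"
  where "pos_def A \<longleftrightarrow> hermitian A \<and> (\<forall>X. hermitian X \<and> X \<noteq> 0 \<longrightarrow> 0 < rtr (A \<odot> (X \<odot> X)))"


section \<open>Eigenvalues, determinant, generalised power\<close>

text \<open>
  All notions are relative to a set \<open>I\<close> of indices, so that they apply to principal submatrices:
  \<open>msub I A\<close> is the principal submatrix of \<open>A\<close> with rows and columns in \<open>I\<close>, padded by zeros.
\<close>

definition msub :: "'m::finite set \<Rightarrow> 'a::hurwitz_algebra^'m^'m \<Rightarrow> 'a^'m^'m"
  where "msub I A = (\<chi> i j. if i \<in> I \<and> j \<in> I then A $ i $ j else 0)"

text \<open>
  Spectral resolution \<open>A = \<Sum>\<^sub>i \<lambda>\<^sub>i c\<^sub>i\<close> with as many nonzero, mutually orthogonal Hermitian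
  idempotents \<open>c\<^sub>i\<close> (a Jordan frame) as there are indices; the \<open>\<lambda>\<^sub>i\<close> are the eigenvalues of \<open>A\<close> with
  multiplicities.  Over an associative algebra the \<open>c\<^sub>i\<close> are the orthogonal projections onto lines
  spanned by eigenvectors (see \<open>spectral_resolution_eigen\<close>).  In the Albert algebra this is the
  spectral theorem of Freudenthal, and the \<open>\<lambda>\<^sub>i\<close> are the three roots of the characteristic equation.
\<close>

definition spectral_resolution ::
  "'m::finite set \<Rightarrow> 'a::hurwitz_algebra^'m^'m \<Rightarrow> ('m \<Rightarrow> 'a^'m^'m) \<Rightarrow> ('m \<Rightarrow> real) \<Rightarrow> bool"
  where "spectral_resolution I A c lam \<longleftrightarrow>
    (\<forall>i\<in>I. hermitian (c i) \<and> msub I (c i) = c i \<and> c i \<noteq> 0) \<and>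
    (\<forall>i\<in>I. \<forall>j\<in>I. jprod (c i) (c j) = (if i = j then c i else 0)) \<and>
    (\<Sum>i\<in>I. c i) = msub I (mat 1) \<and>
    (\<Sum>i\<in>I. lam i *\<^sub>R c i) = msub I A"

text \<open>
  Determinant of a Hermitian matrix: the product of its eigenvalues.  The value 0 is a convention
  for matrices that do not have a spectral resolution (non-Hermitian ones, and some octonionic
  ones of size above 3, where the notion does not exist).
\<close>

definition hdet_on :: "'m::finite set \<Rightarrow> 'a::hurwitz_algebra^'m^'m \<Rightarrow> real"
  where "hdet_on I A =
    (if \<exists>!d. \<exists>c lam. spectral_resolution I A c lam \<and> d = prod lam I
     then (THE d. \<exists>c lam. spectral_resolution I A c lam \<and> d = prod lam I) else 0)"

definition hdet :: "'a::hurwitz_algebra^'m^'m \<Rightarrow> real"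
  where "hdet A = hdet_on UNIV A"

text \<open>Determinant of the leading principal \<open>p \<times> p\<close> submatrix; \<open>card {..i}\<close> is the position of \<open>i\<close>.\<close>

definition lead_minor :: "nat \<Rightarrow> 'a::hurwitz_algebra^'m::{finite,linorder}^'m::{finite,linorder} \<Rightarrow> real"
  where "lead_minor p A = hdet_on {i. card {..i} \<le> p} A"

text \<open>The weight \<open>\<kappa> = (k\<^sub>1, \<dots>, k\<^sub>m)\<close> is a function on \<^typ>\<open>nat\<close> of which only the values at \<open>1, \<dots>, m\<close> are used.\<close>

definition gen_power :: "(nat \<Rightarrow> real) \<Rightarrow> 'a::hurwitz_algebra^'m::{finite,linorder}^'m::{finite,linorder} \<Rightarrow> real"
  where "gen_power \<kappa> A =
    lead_minor CARD('m) A powr \<kappa> CARD('m) *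
    (\<Prod>i = 1..<CARD('m). lead_minor i A powr (\<kappa> i - \<kappa> (i + 1)))"

definition chol :: "'a::hurwitz_algebra^'m::{finite,linorder}^'m::{finite,linorder}
    \<Rightarrow> 'a^'m::{finite,linorder}^'m::{finite,linorder}"
  where "chol B = (THE U. (\<forall>i j. j < i \<longrightarrow> U $ i $ j = 0) \<and> (\<forall>i. \<exists>r>0. U $ i $ i = r *\<^sub>R 1) \<and>
    madj U \<odot> U = B)"

text \<open>
  Rank \<open>m \<le> n\<close> (the \<open>m\<close> columns are right linearly independent) and \<open>m\<close> distinct positive singular
  values, the square roots of the eigenvalues of \<open>A\<^sup>* A\<close>.
\<close>

definition full_rank_distinct_sv :: "'a::hurwitz_algebra^'m^'n \<Rightarrow> bool"
  where "full_rank_distinct_sv A \<longleftrightarrow>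
    CARD('m) \<le> CARD('n) \<and>
    (\<forall>x::'a^'m. (\<chi> i. \<Sum>j\<in>UNIV. A $ i $ j * x $ j) = 0 \<longrightarrow> x = 0) \<and>
    (\<exists>c sv. spectral_resolution UNIV (madj A \<odot> A) c (\<lambda>i. (sv i)\<^sup>2) \<and> (\<forall>i. 0 < sv i) \<and> inj sv)"


section \<open>Gamma functions and densities\<close>

definition mgamma :: "nat \<Rightarrow> real \<Rightarrow> real \<Rightarrow> real"
  where "mgamma m \<beta> a = pi powr (real m * (real m - 1) * \<beta> / 4) *
    (\<Prod>i = 1..m. Gamma (a - (real i - 1) * \<beta> / 2))"

definition mgamma_wt :: "nat \<Rightarrow> real \<Rightarrow> real \<Rightarrow> (nat \<Rightarrow> real) \<Rightarrow> real"
  where "mgamma_wt m \<beta> a \<kappa> = pi powr (real m * (real m - 1) * \<beta> / 4) *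
    (\<Prod>i = 1..m. Gamma (a + \<kappa> i - (real i - 1) * \<beta> / 2))"

definition riesz1_density :: "real \<Rightarrow> real \<Rightarrow> real \<Rightarrow> real \<Rightarrow> real \<Rightarrow> real"
  where "riesz1_density \<beta> a k \<rho> s =
    (if 0 < s
     then \<beta> powr (a + k) / (Gamma (a + k) * \<rho> powr (a + k)) * exp (- \<beta> * s / \<rho>) * s powr (a + k - 1)
     else 0)"

definition kotz_riesz1_density ::
  "(nat \<Rightarrow> real) \<Rightarrow> 'a::hurwitz_algebra^'m::{finite,linorder}^'n \<Rightarrow> 'a^'n^'n \<Rightarrow>
    'a^'m::{finite,linorder}^'m::{finite,linorder} \<Rightarrow> 'a^'m::{finite,linorder}^'n \<Rightarrow> real"
  where "kotz_riesz1_density \<kappa> \<mu> \<Theta> \<Sigma> Y =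
    (let m = CARD('m); n = CARD('n); \<beta> = real DIM('a);
         W = mcong (Y - \<mu>) (hinv \<Theta>)
     in \<beta> powr (m * n * \<beta> / 2 + (\<Sum>i = 1..m. \<kappa> i)) * mgamma m \<beta> (n * \<beta> / 2) /
        (pi powr (m * n * \<beta> / 2) * mgamma_wt m \<beta> (n * \<beta> / 2) \<kappa> *
         hdet \<Sigma> powr (n * \<beta> / 2) * hdet \<Theta> powr (m * \<beta> / 2)) *
        exp (- \<beta> * rtr (hinv \<Sigma> \<odot> W)) *
        gen_power \<kappa> (mcong (minv (chol \<Sigma>)) W))"


section \<open>Agreement with the usual notions over an associative algebra\<close>

lemma mmul_add_left: "(A + B) \<odot> C = A \<odot> C + B \<odot> C"
  by (simp add: mmul_def vec_eq_iff hz_add_left sum.distrib)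

lemma mmul_add_right: "A \<odot> (B + C) = A \<odot> B + A \<odot> C"
  by (simp add: mmul_def vec_eq_iff hz_add_right sum.distrib)

lemma mmul_scaleR_left: "(r *\<^sub>R A) \<odot> B = r *\<^sub>R (A \<odot> B)"
  by (simp add: mmul_def vec_eq_iff hz_scaleR_left scaleR_sum_right)

lemma mmul_scaleR_right: "A \<odot> (r *\<^sub>R B) = r *\<^sub>R (A \<odot> B)"
  by (simp add: mmul_def vec_eq_iff hz_scaleR_right scaleR_sum_right)

lemma mmul_0_left [simp]: "0 \<odot> B = 0"
  by (simp add: mmul_def vec_eq_iff)

lemma mmul_0_right [simp]: "A \<odot> 0 = 0"
  by (simp add: mmul_def vec_eq_iff)

lemma mmul_1_left [simp]: "mat 1 \<odot> A = A"
  by (simp add: mmul_def vec_eq_iff mat_def if_distrib[of "\<lambda>x. x * _"] hz_one_left sum.delta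
      cong: if_cong)

lemma mmul_1_right [simp]: "A \<odot> mat 1 = A"
  by (simp add: mmul_def vec_eq_iff mat_def if_distrib[of "\<lambda>x. _ * x"] hz_one_right sum.delta
      cong: if_cong)

lemma hz_sum_left: "(\<Sum>i\<in>I. f i) * x = (\<Sum>i\<in>I. f i * (x::'a::hurwitz_algebra))"
  by (induction I rule: infinite_finite_induct) (simp_all add: hz_add_left)

lemma hz_sum_right: "x * (\<Sum>i\<in>I. f i) = (\<Sum>i\<in>I. x * (f i::'a::hurwitz_algebra))"
  by (induction I rule: infinite_finite_induct) (simp_all add: hz_add_right)

lemma hcnj_sum: "hcnj (\<Sum>i\<in>I. f i) = (\<Sum>i\<in>I. hcnj (f i::'a::hurwitz_algebra))"
  by (induction I rule: infinite_finite_induct) (simp_all add: hcnj_add)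

lemma mmul_assoc: "(A \<odot> B) \<odot> C = A \<odot> (B \<odot> (C::'a::hurwitz_algebra_assoc^_^_))"
  unfolding mmul_def vec_eq_iff
  by (auto simp: hz_sum_left hz_sum_right hz_assoc intro: sum.swap)

lemma madj_mmul: "madj (A \<odot> B) = madj B \<odot> madj A"
  by (simp add: madj_def mmul_def vec_eq_iff hcnj_sum hcnj_mult)

lemma madj_madj [simp]: "madj (madj A) = A"
  by (simp add: madj_def vec_eq_iff)

lemma madj_mat_1 [simp]: "madj (mat 1) = mat 1"
  by (auto simp: madj_def mat_def vec_eq_iff)

lemma mcong_assoc: "mcong P W = madj P \<odot> W \<odot> (P::'a::hurwitz_algebra_assoc^_^_)"
  by (simp add: mcong_def mmul_assoc flip: scaleR_2)

lemma two_jprod: "2 *\<^sub>R jprod A B = A \<odot> B + B \<odot> A"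
  by (simp add: jprod_def)

lemma jprod_self: "jprod A A = A \<odot> A"
  by (simp add: jprod_def flip: scaleR_2)

lemma jordan_inverse_assoc:
  fixes A B :: "'a::hurwitz_algebra_assoc^'m^'m"
  shows "jprod A B = mat 1 \<and> jprod (A \<odot> A) B = A \<longleftrightarrow> A \<odot> B = mat 1 \<and> B \<odot> A = mat 1"
proof (intro iffI)
  assume *: "A \<odot> B = mat 1 \<and> B \<odot> A = mat 1"
  then have "A \<odot> A \<odot> B = A" "B \<odot> (A \<odot> A) = A"
    by (simp_all add: mmul_assoc flip: mmul_assoc[of B])
  with * show "jprod A B = mat 1 \<and> jprod (A \<odot> A) B = A"
    by (simp add: jprod_def flip: scaleR_2)
next
  assume *: "jprod A B = mat 1 \<and> jprod (A \<odot> A) B = A"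
  have 1: "A \<odot> B + B \<odot> A = 2 *\<^sub>R mat 1"
    using * two_jprod[of A B] by simp
  have 2: "A \<odot> A \<odot> B + B \<odot> (A \<odot> A) = 2 *\<^sub>R A"
    using * two_jprod[of "A \<odot> A" B] by simp
  have 3: "A \<odot> A \<odot> B + A \<odot> (B \<odot> A) = 2 *\<^sub>R A" "A \<odot> (B \<odot> A) + B \<odot> (A \<odot> A) = 2 *\<^sub>R A"
    using arg_cong[OF 1, of "(\<odot>) A"] arg_cong[OF 1, of "\<lambda>X. X \<odot> A"]
    by (simp_all add: mmul_add_left mmul_add_right mmul_scaleR_left mmul_scaleR_right mmul_assoc)
  have "A \<odot> A \<odot> B = B \<odot> (A \<odot> A)"
    using 3 by (metis add.commute add_left_cancel)
  with 2 have "2 *\<^sub>R (A \<odot> A \<odot> B) = 2 *\<^sub>R A"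
    by (simp add: scaleR_2)
  then have AAB: "A \<odot> A \<odot> B = A"
    by simp
  with 3(1) have ABA: "A \<odot> (B \<odot> A) = A"
    by (simp add: scaleR_2)
  define E where "E = A \<odot> B"
  have BA: "B \<odot> A = 2 *\<^sub>R mat 1 - E"
    using 1 by (simp add: E_def eq_diff_eq add.commute)
  have "E \<odot> E = A \<odot> (B \<odot> A) \<odot> B"
    by (simp add: E_def mmul_assoc)
  then have EE: "E \<odot> E = E"
    by (simp add: ABA E_def)
  have AE: "A \<odot> E = A"
    using AAB by (simp add: E_def mmul_assoc)
  have "B \<odot> A \<odot> E = B \<odot> A"
    using AE by (simp add: mmul_assoc)
  then have "(2 *\<^sub>R mat 1 - E) \<odot> E = 2 *\<^sub>R mat 1 - E"
    by (simp add: BA)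
  moreover have "(2 *\<^sub>R mat 1 - E) \<odot> E = 2 *\<^sub>R E - E"
    using mmul_add_left[of "2 *\<^sub>R mat 1 - E" E E] EE by (simp add: mmul_scaleR_left eq_diff_eq)
  ultimately have "2 *\<^sub>R E = 2 *\<^sub>R mat 1"
    by simp
  then have "E = mat 1"
    by simp
  with BA show "A \<odot> B = mat 1 \<and> B \<odot> A = mat 1"
    by (simp add: E_def scaleR_2)
qed

lemma hinv_assoc:
  fixes A :: "'a::hurwitz_algebra_assoc^'m^'m"
  assumes "hermitian A"
  shows "hinv A = minv A"
proof -
  have "hermitian B" if "A \<odot> B = mat 1" "B \<odot> A = mat 1" for B
  proof -
    have "A \<odot> madj B = mat 1"
      using arg_cong[OF that(2), of madj] assms by (simp add: madj_mmul hermitian_def)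
    then show ?thesis
      unfolding hermitian_def by (metis mmul_1_left mmul_1_right mmul_assoc that(2))
  qed
  then show ?thesis
    unfolding hinv_def minv_def by (metis jordan_inverse_assoc)
qed

lemma minv_assoc:
  fixes A :: "'a::hurwitz_algebra_assoc^'m^'m"
  assumes "A \<odot> B = mat 1" "B \<odot> A = mat 1"
  shows "minv A = B"
  unfolding minv_def using assms by (intro the_equality) (metis mmul_1_left mmul_1_right mmul_assoc)+

lemma spectral_resolution_eigen:
  fixes A :: "'a::hurwitz_algebra_assoc^'m^'m"
  assumes "spectral_resolution I A c lam" "i \<in> I"
  shows "c i \<odot> c i = c i" "j \<in> I \<Longrightarrow> j \<noteq> i \<Longrightarrow> c i \<odot> c j = 0" "msub I A \<odot> c i = lam i *\<^sub>R c i"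
proof -
  have idem: "c j \<odot> c j = c j" if "j \<in> I" for j
    using assms(1) that by (auto simp: spectral_resolution_def simp flip: jprod_self)
  have orth: "c j \<odot> c k = 0" if "j \<in> I" "k \<in> I" "j \<noteq> k" for j k
  proof -
    have *: "c j \<odot> c k + c k \<odot> c j = 0"
      using assms(1) that two_jprod[of "c j" "c k"] by (simp add: spectral_resolution_def)
    have "c j \<odot> c k + c j \<odot> (c k \<odot> c j) = 0" "c j \<odot> (c k \<odot> c j) + c k \<odot> c j = 0"
      using arg_cong[OF *, of "(\<odot>) (c j)"] arg_cong[OF *, of "\<lambda>X. X \<odot> c j"] idem[OF that(1)]
      by (simp_all add: mmul_add_left mmul_add_right mmul_assoc flip: mmul_assoc[of "c j" "c j" "c k"])
    then have "c j \<odot> c k = c k \<odot> c j"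
      by (metis add.commute add_left_cancel)
    with * have "2 *\<^sub>R (c j \<odot> c k) = 0"
      by (simp add: scaleR_2)
    then show ?thesis
      by simp
  qed
  show "c i \<odot> c i = c i" "j \<in> I \<Longrightarrow> j \<noteq> i \<Longrightarrow> c i \<odot> c j = 0"
    using idem orth assms(2) by auto
  have "(\<Sum>j\<in>J. lam j *\<^sub>R c j) \<odot> c i = (\<Sum>j\<in>J. lam j *\<^sub>R (c j \<odot> c i))" for J
    by (induction J rule: infinite_finite_induct) (simp_all add: mmul_add_left mmul_scaleR_left)
  then have "msub I A \<odot> c i = (\<Sum>j\<in>I. lam j *\<^sub>R (c j \<odot> c i))"
    using assms(1) by (metis spectral_resolution_def)
  also have "\<dots> = (\<Sum>j\<in>I. if j = i then lam i *\<^sub>R c i else 0)"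
    using idem orth assms(2) by (intro sum.cong) auto
  finally show "msub I A \<odot> c i = lam i *\<^sub>R c i"
    using assms(2) by simp
qed

lemma hRe_hcnj_mult: "hRe (hcnj x * y) = inner x y"
  using hz_adjoint_left[of "hcnj x" y 1] by (simp add: hRe_def hz_one_right inner_commute)

lemma hRe_commute: "hRe (x * y) = hRe (y * x)"
  using hz_adjoint_left[of x y 1] hz_adjoint_right[of y x 1]
  by (simp add: hRe_def hz_one_left hz_one_right)

lemma hRe_sum: "hRe (\<Sum>i\<in>I. f i) = (\<Sum>i\<in>I. hRe (f i))"
  by (simp add: hRe_def inner_sum_left)

lemma rtr_commute: "rtr (A \<odot> B) = rtr (B \<odot> A)"
  unfolding rtr_def mmul_def
  by (simp add: hRe_sum hRe_commute[of "A $ _ $ _"]) (rule sum.swap)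

definition col_mat :: "'a^'m \<Rightarrow> 'a^1^'m"
  where "col_mat x = (\<chi> i j. x $ i)"

lemma rtr_1: "rtr (A::'a::hurwitz_algebra^1^1) = hRe (A $ 1 $ 1)"
  by (simp add: rtr_def)

lemma madj_col_self:
  "madj (col_mat x) \<odot> col_mat x = inner x x *\<^sub>R (mat 1 :: 'a::hurwitz_algebra^1^1)"
  by (simp add: vec_eq_iff mmul_def madj_def col_mat_def mat_def hcnj_mult_self inner_vec_def
      flip: scaleR_sum_left)

lemma rtr_sandwich_columns:
  fixes A X :: "'a::hurwitz_algebra_assoc^'m^'m"
  shows "rtr (madj X \<odot> A \<odot> X)
    = (\<Sum>j\<in>UNIV. hRe ((madj (col_mat (\<chi> i. X $ i $ j)) \<odot> A \<odot> col_mat (\<chi> i. X $ i $ j)) $ 1 $ 1))"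
  by (simp add: rtr_def mmul_def madj_def col_mat_def)

lemma pos_def_assoc:
  fixes A :: "'a::hurwitz_algebra_assoc^'m^'m"
  shows "pos_def A \<longleftrightarrow>
    hermitian A \<and> (\<forall>x. x \<noteq> 0 \<longrightarrow> 0 < hRe ((madj (col_mat x) \<odot> A \<odot> col_mat x) $ 1 $ 1))"
proof (intro iffI conjI allI impI)
  assume A: "pos_def A"
  then show "hermitian A"
    by (simp add: pos_def_def)
  fix x :: "'a^'m" assume x: "x \<noteq> 0"
  define X where "X = col_mat x \<odot> madj (col_mat x)"
  have XX: "X \<odot> X = inner x x *\<^sub>R X"
  proof -
    have "X \<odot> X = col_mat x \<odot> (madj (col_mat x) \<odot> col_mat x) \<odot> madj (col_mat x)"
      by (simp add: X_def mmul_assoc)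
    then show ?thesis
      by (simp add: madj_col_self mmul_scaleR_left mmul_scaleR_right X_def)
  qed
  have tr: "rtr (r *\<^sub>R B) = r * rtr B" for r and B :: "'a^'m^'m"
    by (simp add: rtr_def hRe_def sum_distrib_left)
  have "rtr X = inner x x"
    unfolding X_def
    by (subst rtr_commute) (simp add: madj_col_self rtr_1 mat_def hRe_def hz_inner_1)
  then have "X \<noteq> 0"
    using x by (auto simp: rtr_def hRe_def)
  moreover have "hermitian X"
    by (simp add: X_def hermitian_def madj_mmul)
  ultimately have "0 < rtr (A \<odot> (X \<odot> X))"
    using A by (simp add: pos_def_def)
  also have "\<dots> = inner x x * rtr (A \<odot> X)"
    by (simp add: XX mmul_scaleR_right tr)
  also have "rtr (A \<odot> X) = rtr (madj (col_mat x) \<odot> A \<odot> col_mat x)"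
    using rtr_commute[of "A \<odot> col_mat x" "madj (col_mat x)"] by (simp add: X_def mmul_assoc)
  finally show "0 < hRe ((madj (col_mat x) \<odot> A \<odot> col_mat x) $ 1 $ 1)"
    using x by (metis inner_gt_zero_iff rtr_1 zero_less_mult_pos)
next
  assume A: "hermitian A \<and> (\<forall>x. x \<noteq> 0 \<longrightarrow> 0 < hRe ((madj (col_mat x) \<odot> A \<odot> col_mat x) $ 1 $ 1))"
  show "pos_def A"
    unfolding pos_def_def
  proof (intro conjI allI impI)
    fix X :: "'a^'m^'m" assume X: "hermitian X \<and> X \<noteq> 0"
    define f where "f j = (\<chi> i. X $ i $ j)" for j
    define g where "g x = hRe ((madj (col_mat x) \<odot> A \<odot> col_mat x) $ 1 $ 1)" for x
    have "g 0 = 0"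
      by (simp add: g_def mmul_def col_mat_def hRe_def)
    then have ge: "0 \<le> g x" for x
      using A by (cases "x = 0") (auto simp: g_def less_imp_le)
    obtain j where "f j \<noteq> 0"
      using X by (auto simp: f_def vec_eq_iff)
    then have "0 < (\<Sum>j\<in>UNIV. g (f j))"
      using A ge by (intro sum_pos2[of _ j]) (auto simp: g_def)
    also have "\<dots> = rtr (madj X \<odot> A \<odot> X)"
      by (simp add: rtr_sandwich_columns g_def f_def)
    also have "\<dots> = rtr (A \<odot> (X \<odot> X))"
      using X rtr_commute[of X "A \<odot> X"] by (simp add: hermitian_def mmul_assoc)
    finally show "0 < rtr (A \<odot> (X \<odot> X))" .
  qed (use A in auto)
qed

end

theory Submission
  imports Defs
begin

text \<open>
  Write the density of \<open>Y\<close> as \<open>C exp (- \<beta> Q y) g y\<close>, where \<open>Q\<close> is the trace and \<open>g\<close> the generalised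
  power.  Conditionally on \<open>S = s\<close> the density of \<open>T\<close> is a rescaling of that of \<open>Y\<close>, and since \<open>Q\<close> and
  \<open>g\<close> are homogeneous of degrees \<open>2\<close> and \<open>2 \<Sum> t\<^sub>i\<close>, integrating out \<open>s\<close> leaves a gamma integral.

  Its convergence needs \<open>Q \<ge> 0\<close> and positivity of the exponent.  Instead of deducing these from
  positive definiteness, which would need the spectral theory of Hermitian matrices over each algebra
  and is not available for large octonionic matrices, they are read off from the fact that the density of \<open>Y\<close>
  has integral \<open>1\<close>.
\<close>

section \<open>Integral formulas and the law of an independent pair\<close>

text \<open>The Jacobian is written with \<open>powr\<close> so that it merges with the real
  exponents of the gamma integral and of the homogeneous weight.\<close>

lemma nn_integral_lborel_affine:
  fixes t :: "'b::euclidean_space"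
  assumes [measurable]: "f \<in> borel_measurable borel" and c: "0 < c"
  shows "(\<integral>\<^sup>+x. f x \<partial>lborel) = ennreal (c powr DIM('b)) * (\<integral>\<^sup>+x. f (t + c *\<^sub>R x) \<partial>lborel)"
  using c by (subst lborel_affine[of c t])
    (simp_all add: nn_integral_density nn_integral_distr nn_integral_cmult powr_realpow)

text \<open>Substitute \<open>q * s\<close> for the variable of Euler's integral. The open half-line
  is the support on which the Riesz density is given by its formula.\<close>

lemma nn_integral_powr_exp:
  assumes q: "0 < q" and a: "0 < (a::real)"
  shows "(\<integral>\<^sup>+s. ennreal (indicator {0<..} s * (s powr (a - 1) * exp (- q * s))) \<partial>lborel)
    = ennreal (Gamma a / q powr a)"
proof -
  let ?f = "\<lambda>s. ennreal (indicator {0<..} s * (s powr (a - 1) * exp (- q * s)))"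
  have "ennreal (Gamma a) = (\<integral>\<^sup>+s. ennreal (indicator {0..} s * s powr (a - 1) / exp s) \<partial>lborel)"
    using a by (rule Gamma_conv_nn_integral_real)
  also have "\<dots> = ennreal \<bar>q\<bar> *
      (\<integral>\<^sup>+s. ennreal (indicator {0..} (0 + q * s) * (0 + q * s) powr (a - 1) / exp (0 + q * s)) \<partial>lborel)"
    using q by (intro nn_integral_real_affine) auto
  also have "(\<integral>\<^sup>+s. ennreal (indicator {0..} (0 + q * s) * (0 + q * s) powr (a - 1) / exp (0 + q * s)) \<partial>lborel)
      = (\<integral>\<^sup>+s. ennreal (q powr (a - 1)) * ?f s \<partial>lborel)"
  proof (intro nn_integral_cong)
    fix s
    \<comment> \<open>The two indicators differ only at \<open>s = 0\<close>, where the left side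
      vanishes as well because \<open>0 powr (a - 1) = 0\<close>.\<close>
    have "indicator {0..} (0 + q * s) * (0 + q * s) powr (a - 1) / exp (0 + q * s)
      = q powr (a - 1) * (indicator {0<..} s * (s powr (a - 1) * exp (- q * s)))"
      using q by (cases "s = 0")
        (auto simp: indicator_def powr_mult exp_minus field_simps zero_le_mult_iff)
    then show "ennreal (indicator {0..} (0 + q * s) * (0 + q * s) powr (a - 1) / exp (0 + q * s))
        = ennreal (q powr (a - 1)) * ?f s"
      by (simp add: ennreal_mult')
  qed
  also have "\<dots> = ennreal (q powr (a - 1)) * (\<integral>\<^sup>+s. ?f s \<partial>lborel)"
    by (rule nn_integral_cmult) measurable
  also have "ennreal \<bar>q\<bar> * (ennreal (q powr (a - 1)) * (\<integral>\<^sup>+s. ?f s \<partial>lborel))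
      = ennreal (q powr a) * (\<integral>\<^sup>+s. ?f s \<partial>lborel)"
  proof -
    have "q * q powr (a - 1) = q powr a"
      using q by (simp add: powr_diff)
    then show ?thesis
      using q by (simp flip: ennreal_mult mult.assoc)
  qed
  finally have "ennreal (Gamma a) / ennreal (q powr a) = (\<integral>\<^sup>+s. ?f s \<partial>lborel)"
    using q by (simp add: ennreal_mult_divide_eq mult.commute[of "ennreal (q powr a)"])
  then show ?thesis
    using q a by (simp add: divide_ennreal Gamma_real_pos less_imp_le)
qed

text \<open>The library's \<open>indep_var\<close> requires both random variables to have the same type.\<close>

lemma (in prob_space) distr_pair_of_indep_set:
  assumes X [measurable]: "random_variable N X" and Y [measurable]: "random_variable L Y"
    and indep: "indep_set {X -` A \<inter> space M | A. A \<in> sets N} {Y -` B \<inter> space M | B. B \<in> sets L}"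
  shows "distr M N X \<Otimes>\<^sub>M distr M L Y = distr M (N \<Otimes>\<^sub>M L) (\<lambda>\<omega>. (X \<omega>, Y \<omega>))"
proof (rule pair_measure_eqI)
  show "sigma_finite_measure (distr M N X)" "sigma_finite_measure (distr M L Y)"
    by (simp_all add: prob_space_distr prob_space_imp_sigma_finite)
  show "sets (distr M N X \<Otimes>\<^sub>M distr M L Y) = sets (distr M (N \<Otimes>\<^sub>M L) (\<lambda>\<omega>. (X \<omega>, Y \<omega>)))"
    by (simp cong: sets_pair_measure_cong)
  fix A B assume "A \<in> sets (distr M N X)" "B \<in> sets (distr M L Y)"
  then have [measurable]: "A \<in> sets N" "B \<in> sets L"
    by auto
  have "prob ((X -` A \<inter> space M) \<inter> (Y -` B \<inter> space M)) =
      prob (X -` A \<inter> space M) * prob (Y -` B \<inter> space M)"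
    using indep by (rule indep_setD) (use \<open>A \<in> sets N\<close> \<open>B \<in> sets L\<close> in blast)+
  moreover have "(\<lambda>\<omega>. (X \<omega>, Y \<omega>)) -` (A \<times> B) \<inter> space M = (X -` A \<inter> space M) \<inter> (Y -` B \<inter> space M)"
    by auto
  ultimately show "emeasure (distr M N X) A * emeasure (distr M L Y) B =
      emeasure (distr M (N \<Otimes>\<^sub>M L) (\<lambda>\<omega>. (X \<omega>, Y \<omega>))) (A \<times> B)"
    by (simp add: emeasure_distr emeasure_eq_measure ennreal_mult')
qed

section \<open>Density of the scaled and shifted vector as a mixture\<close>

text \<open>The pair has joint density \<open>f s * h y\<close>. For fixed \<open>s\<close> the
  variable \<open>y\<close> is replaced by \<open>t\<close>, and Tonelli's theorem then puts the
  integral over \<open>s\<close> inside.\<close>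

lemma (in prob_space) distributed_inverse_sqrt_scaling:
  fixes S :: "'a \<Rightarrow> real" and Y :: "'a \<Rightarrow> 'b::euclidean_space"
  assumes S: "distributed M lborel S f" and Y: "distributed M lborel Y h"
    and indep: "indep_set {S -` A \<inter> space M | A. A \<in> sets borel} {Y -` B \<inter> space M | B. B \<in> sets borel}"
    and f0: "\<And>s. s \<le> 0 \<Longrightarrow> f s = 0"
  shows "distributed M lborel (\<lambda>\<omega>. (1 / sqrt (S \<omega>)) *\<^sub>R Y \<omega> + \<mu>)
    (\<lambda>t. \<integral>\<^sup>+s. f s * (ennreal (s powr (DIM('b) / 2)) * h (sqrt s *\<^sub>R (t - \<mu>))) \<partial>lborel)"
    (is "distributed M lborel ?T ?F")
proof -
  have [measurable]: "f \<in> borel_measurable borel" "h \<in> borel_measurable borel"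
    using distributed_borel_measurable[OF S] distributed_borel_measurable[OF Y] by auto
  have [measurable]: "S \<in> borel_measurable M" "Y \<in> borel_measurable M"
    using distributed_measurable[OF S] distributed_measurable[OF Y] by auto
  have SY: "distr M (lborel \<Otimes>\<^sub>M lborel) (\<lambda>x. (S x, Y x))
      = density (lborel \<Otimes>\<^sub>M lborel) (\<lambda>(x, y). f x * h y)"
    by (rule distributed_distr_eq_density, rule distributed_joint_indep'[OF sigma_finite_lborel sigma_finite_lborel S Y],
        rule distr_pair_of_indep_set) (use indep in simp_all)
  let ?H = "\<lambda>(s, y). (1 / sqrt s) *\<^sub>R y + \<mu> :: 'b"
  have "distr M lborel ?T = density lborel ?F"
  proof (rule measure_eqI)
    fix B assume "B \<in> sets (distr M lborel ?T)"
    then have [measurable]: "B \<in> sets borel"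
      by simp
    have sub: "(\<integral>\<^sup>+y. f s * h y * indicator B ((1 / sqrt s) *\<^sub>R y + \<mu>) \<partial>lborel)
        = (\<integral>\<^sup>+t. f s * (ennreal (s powr (DIM('b) / 2)) * h (sqrt s *\<^sub>R (t - \<mu>))) * indicator B t \<partial>lborel)" for s
    proof (cases "0 < s")
      case True
      have "(\<integral>\<^sup>+y. f s * h y * indicator B ((1 / sqrt s) *\<^sub>R y + \<mu>) \<partial>lborel)
        = ennreal (sqrt s powr DIM('b)) *
          (\<integral>\<^sup>+t. f s * h (- sqrt s *\<^sub>R \<mu> + sqrt s *\<^sub>R t) *
            indicator B ((1 / sqrt s) *\<^sub>R (- sqrt s *\<^sub>R \<mu> + sqrt s *\<^sub>R t) + \<mu>) \<partial>lborel)"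
        using True by (intro nn_integral_lborel_affine) auto
      also have "\<dots> = (\<integral>\<^sup>+t. ennreal (sqrt s powr DIM('b)) * (f s * h (- sqrt s *\<^sub>R \<mu> + sqrt s *\<^sub>R t) *
            indicator B ((1 / sqrt s) *\<^sub>R (- sqrt s *\<^sub>R \<mu> + sqrt s *\<^sub>R t) + \<mu>)) \<partial>lborel)"
        by (rule nn_integral_cmult[symmetric]) measurable
      also have "sqrt s powr DIM('b) = s powr (DIM('b) / 2)"
        using True by (simp add: powr_half_sqrt[symmetric] powr_powr)
      also have "(\<lambda>t. (1 / sqrt s) *\<^sub>R (- sqrt s *\<^sub>R \<mu> + sqrt s *\<^sub>R t) + \<mu>) = (\<lambda>t. t)"
        using True by (auto simp: scaleR_add_right scaleR_diff_right)
      also have "(\<lambda>t. - sqrt s *\<^sub>R \<mu> + sqrt s *\<^sub>R t) = (\<lambda>t. sqrt s *\<^sub>R (t - \<mu>))"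
        by (auto simp: algebra_simps)
      finally show ?thesis
        by (simp add: ac_simps)
    qed (simp add: f0)
    have "emeasure (distr M lborel ?T) B
      = emeasure (distr (distr M (lborel \<Otimes>\<^sub>M lborel) (\<lambda>x. (S x, Y x))) lborel ?H) B"
      by (subst distr_distr) (auto simp: comp_def)
    also have "\<dots> = (\<integral>\<^sup>+z. (\<lambda>(x, y). f x * h y) z * indicator B (?H z) \<partial>(lborel \<Otimes>\<^sub>M lborel))"
    proof -
      have "?H -` B \<inter> space (lborel \<Otimes>\<^sub>M lborel) \<in> sets (lborel \<Otimes>\<^sub>M lborel)"
        by (rule measurable_sets[of ?H _ borel]) auto
      then show ?thesis
        unfolding SY
        by (subst emeasure_distr)
          (auto simp: emeasure_density space_pair_measure indicator_def intro!: nn_integral_cong)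
    qed
    also have "\<dots> = (\<integral>\<^sup>+s. \<integral>\<^sup>+y. f s * h y * indicator B ((1 / sqrt s) *\<^sub>R y + \<mu>) \<partial>lborel \<partial>lborel)"
      by (subst lborel.nn_integral_fst[symmetric]) auto
    also have "\<dots> = (\<integral>\<^sup>+s. \<integral>\<^sup>+t. f s * (ennreal (s powr (DIM('b) / 2)) * h (sqrt s *\<^sub>R (t - \<mu>))) *
        indicator B t \<partial>lborel \<partial>lborel)"
      by (simp only: sub)
    also have "\<dots> = (\<integral>\<^sup>+t. \<integral>\<^sup>+s. f s * (ennreal (s powr (DIM('b) / 2)) * h (sqrt s *\<^sub>R (t - \<mu>))) *
        indicator B t \<partial>lborel \<partial>lborel)"
      by (rule lborel_pair.Fubini') measurable
    also have "\<dots> = emeasure (density lborel ?F) B"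
      by (subst emeasure_density) (auto simp: nn_integral_multc)
    finally show "emeasure (distr M lborel ?T) B = emeasure (density lborel ?F) B" .
  qed simp
  then show ?thesis
    unfolding distributed_def by auto
qed

section \<open>Sign of the quadratic form and of the exponent\<close>

text \<open>
  Substituting \<open>\<surd>\<lambda> y\<close> for \<open>y\<close> shows that the Laplace transform of \<open>g\<close> along \<open>Q\<close> is the power
  \<open>\<lambda> powr - (DIM/2 + t)\<close>.  It would grow exponentially if \<open>g\<close> charged \<open>{Q < 0}\<close>.
\<close>

lemma homogeneous_exponential_weight:
  fixes Q g :: "'b::euclidean_space \<Rightarrow> real"
  assumes [measurable]: "Q \<in> borel_measurable borel" "g \<in> borel_measurable borel"
    and g0: "\<And>y. 0 \<le> g y"
    and Q_hom: "\<And>r y. 0 < r \<Longrightarrow> Q (r *\<^sub>R y) = r\<^sup>2 * Q y"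
    and g_hom: "\<And>r y. 0 < r \<Longrightarrow> g (r *\<^sub>R y) = r powr (2 * t) * g y"
    and total: "(\<integral>\<^sup>+y. ennreal (exp (- Q y) * g y) \<partial>lborel) = 1"
  shows "AE y in lborel. g y \<noteq> 0 \<longrightarrow> 0 \<le> Q y" and "0 \<le> DIM('b) / 2 + t"
proof -
  define L where "L x = (\<integral>\<^sup>+y. ennreal (exp (- x * Q y) * g y) \<partial>lborel)" for x
  define A where "A = DIM('b) / 2 + t"
  have L: "ennreal (x powr A) * L x = 1" if x: "0 < x" for x
  proof -
    have "1 = ennreal (sqrt x powr DIM('b)) *
        (\<integral>\<^sup>+y. ennreal (exp (- Q (0 + sqrt x *\<^sub>R y)) * g (0 + sqrt x *\<^sub>R y)) \<partial>lborel)"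
      unfolding total[symmetric] using x by (intro nn_integral_lborel_affine) auto
    also have "\<dots> = ennreal (sqrt x powr DIM('b)) *
        (\<integral>\<^sup>+y. ennreal (x powr t) * ennreal (exp (- x * Q y) * g y) \<partial>lborel)"
    proof -
      have "sqrt x powr (2 * t) = x powr t"
        using x by (simp add: powr_half_sqrt[symmetric] powr_powr)
      then show ?thesis
        using x by (simp add: Q_hom g_hom ennreal_mult'[symmetric] ac_simps)
    qed
    also have "\<dots> = ennreal (sqrt x powr DIM('b)) * (ennreal (x powr t) * L x)"
      unfolding L_def by (subst nn_integral_cmult) auto
    also have "\<dots> = ennreal (x powr A) * L x"
      using x by (simp add: A_def powr_half_sqrt[symmetric] powr_powr powr_add ennreal_mult mult.assoc)
    finally show ?thesis by simp
  qed
  have L': "L x = ennreal (x powr - A)" if x: "0 < x" for x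
  proof -
    have "ennreal (x powr - A) * (ennreal (x powr A) * L x) = L x"
      using x by (simp add: mult.assoc[symmetric] ennreal_mult'[symmetric] powr_add[symmetric])
    then show ?thesis
      using L[OF x] by simp
  qed
  \<comment> \<open>Where \<open>Q y \<le> - e\<close>, passing from parameter 1 to \<open>x\<close>
    multiplies the integrand by at least \<open>exp ((x - 1) * e)\<close>. Hence the mass
    \<open>p\<close> of this set satisfies
    \<open>exp ((x - 1) * e) * p \<le> L x = x powr - A\<close> for all
    \<open>x \<ge> 1\<close>.\<close>
  have null: "AE y in lborel. \<not> (g y \<noteq> 0 \<and> Q y \<le> - e)" if e: "0 < e" for e
  proof -
    define p where "p = (\<integral>\<^sup>+y. ennreal (exp (- Q y) * g y) * indicator {y. Q y \<le> - e} y \<partial>lborel)"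
    have le: "ennreal (exp ((x - 1) * e)) * p \<le> ennreal (x powr - A)" if x: "1 \<le> x" for x
    proof -
      have "ennreal (exp ((x - 1) * e)) * p = (\<integral>\<^sup>+y. ennreal (exp ((x - 1) * e)) *
          (ennreal (exp (- Q y) * g y) * indicator {y. Q y \<le> - e} y) \<partial>lborel)"
        unfolding p_def by (rule nn_integral_cmult[symmetric]) measurable
      also have "\<dots> \<le> L x"
        unfolding L_def
      proof (intro nn_integral_mono)
        fix y
        have "exp ((x - 1) * e) * (exp (- Q y) * g y) \<le> exp (- x * Q y) * g y" if "Q y \<le> - e"
        proof -
          have "(x - 1) * e \<le> (x - 1) * (- Q y)"
            using x that by (intro mult_left_mono) auto
          then have "exp ((x - 1) * e + - Q y) \<le> exp (- x * Q y)"
            by (simp add: algebra_simps)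
          then show ?thesis
            unfolding exp_add using g0[of y] by (simp only: mult.assoc[symmetric] mult_right_mono)
        qed
        then show "ennreal (exp ((x - 1) * e)) *
          (ennreal (exp (- Q y) * g y) * indicator {y. Q y \<le> - e} y) \<le> ennreal (exp (- x * Q y) * g y)"
          by (auto simp: ennreal_mult'[symmetric] split: split_indicator intro: ennreal_leI)
      qed
      finally show ?thesis
        using x by (simp add: L')
    qed
    have "p \<le> ennreal (x powr - A * exp (- (x - 1) * e))" if x: "1 \<le> x" for x
    proof -
      have "p = ennreal (exp (- (x - 1) * e)) * (ennreal (exp ((x - 1) * e)) * p)"
        by (simp add: mult.assoc[symmetric] ennreal_mult'[symmetric] exp_add[symmetric] distrib_right[symmetric])
      also have "\<dots> \<le> ennreal (exp (- (x - 1) * e)) * ennreal (x powr - A)"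
        using le[OF x] by (rule mult_left_mono) simp
      finally show ?thesis
        by (simp add: ennreal_mult' mult.commute)
    qed
    \<comment> \<open>The exponential decay dominates the power whatever the sign of
      \<open>A\<close>.\<close>
    moreover have "((\<lambda>x. x powr - A * exp (- (x - 1) * e)) \<longlongrightarrow> 0) at_top"
      using e by real_asymp
    then have "((\<lambda>x. ennreal (x powr - A * exp (- (x - 1) * e))) \<longlongrightarrow> ennreal 0) at_top"
      by (rule tendsto_ennrealI)
    ultimately have "p \<le> ennreal 0"
      by (intro tendsto_lowerbound[of _ _ at_top]) (auto intro: eventually_at_top_linorderI)
    then have "AE y in lborel. ennreal (exp (- Q y) * g y) * indicator {y. Q y \<le> - e} y = 0"
      unfolding p_def by (subst (asm) ennreal_0, subst nn_integral_0_iff_AE[symmetric]) auto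
    then show ?thesis
    proof eventually_elim
      fix y assume "ennreal (exp (- Q y) * g y) * indicator {y. Q y \<le> - e} y = 0"
      then show "\<not> (g y \<noteq> 0 \<and> Q y \<le> - e)"
        using g0[of y] by (auto simp: ennreal_eq_0_iff mult_le_0_iff)
    qed
  qed
  \<comment> \<open>The set where \<open>Q\<close> is negative is the countable union of the sets
    \<open>Q y \<le> - 1 / (i + 1)\<close>.\<close>
  have "AE y in lborel. \<forall>i::nat. \<not> (g y \<noteq> 0 \<and> Q y \<le> - (1 / real (Suc i)))"
    unfolding AE_all_countable by (intro allI null) simp
  then show AE: "AE y in lborel. g y \<noteq> 0 \<longrightarrow> 0 \<le> Q y"
  proof eventually_elim
    fix y assume *: "\<forall>i::nat. \<not> (g y \<noteq> 0 \<and> Q y \<le> - (1 / real (Suc i)))"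
    show "g y \<noteq> 0 \<longrightarrow> 0 \<le> Q y"
    proof (intro impI leI notI)
      assume "g y \<noteq> 0" "Q y < 0"
      obtain i where "inverse (real (Suc i)) < - Q y"
        using reals_Archimedean[of "- Q y"] \<open>Q y < 0\<close> by auto
      then have "Q y \<le> - (1 / real (Suc i))"
        by (simp add: inverse_eq_divide)
      with * \<open>g y \<noteq> 0\<close> show False
        by blast
    qed
  qed
  \<comment> \<open>With \<open>Q\<close> nonnegative where \<open>g\<close> lives, \<open>L\<close>
    is decreasing. Comparing \<open>2 powr - A\<close> with \<open>1 powr - A = 1\<close> gives the
    sign of \<open>A\<close>.\<close>
  have "L 2 \<le> L 1"
    unfolding L_def
  proof (rule nn_integral_mono_AE, use AE in eventually_elim)
    fix y assume "g y \<noteq> 0 \<longrightarrow> 0 \<le> Q y"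
    then show "ennreal (exp (- 2 * Q y) * g y) \<le> ennreal (exp (- 1 * Q y) * g y)"
      using g0[of y] by (cases "g y = 0") (auto intro!: ennreal_leI mult_right_mono)
  qed
  then have "2 powr - A \<le> 2 powr (0::real)"
    by (simp add: L')
  then show "0 \<le> DIM('b) / 2 + t"
    by (subst (asm) powr_le_cancel_iff) (simp_all add: A_def)
qed


section \<open>The T-Riesz density for an abstract homogeneous weight\<close>

text \<open>Only the homogeneity of \<open>Q\<close> and \<open>g\<close> enters, so matrices are
  absent here. Evaluating the mixture over \<open>s\<close> by the gamma integral yields the power
  of \<open>1 + \<rho> * Q\<close>.\<close>

lemma (in prob_space) distributed_T_riesz1:
  fixes S :: "'a \<Rightarrow> real" and Y :: "'a \<Rightarrow> 'b::euclidean_space" and Q g :: "'b \<Rightarrow> real"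
  assumes \<beta>: "0 < \<beta>" and \<rho>: "0 < \<rho>" and ak: "0 < a + k"
    and Q [measurable]: "Q \<in> borel_measurable borel"
    and g0: "\<And>y. 0 \<le> g y"
    and Q_hom: "\<And>r y. 0 < r \<Longrightarrow> Q (r *\<^sub>R y) = r\<^sup>2 * Q y"
    and g_hom: "\<And>r y. 0 < r \<Longrightarrow> g (r *\<^sub>R y) = r powr (2 * t) * g y"
    and S: "distributed M lborel S (\<lambda>s. ennreal (riesz1_density \<beta> a k \<rho> s))"
    and Y: "distributed M lborel Y (\<lambda>y. ennreal (C * exp (- \<beta> * Q y) * g y))"
    and indep: "indep_set {S -` A \<inter> space M | A. A \<in> sets borel} {Y -` B \<inter> space M | B. B \<in> sets borel}"
    and A: "A = a + k + DIM('b) / 2 + t"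
    and c: "c = C * Gamma A * \<rho> powr (DIM('b) / 2 + t) / (\<beta> powr (DIM('b) / 2 + t) * Gamma (a + k))"
  shows "distributed M lborel (\<lambda>\<omega>. (1 / sqrt (S \<omega>)) *\<^sub>R Y \<omega> + \<mu>)
    (\<lambda>T. ennreal (c * (1 + \<rho> * Q (T - \<mu>)) powr (- A) * g (T - \<mu>)))"
proof -
  have h [measurable]: "(\<lambda>y. ennreal (C * exp (- \<beta> * Q y) * g y)) \<in> borel_measurable borel"
    using distributed_borel_measurable[OF Y] by simp
  interpret Y: prob_space "density lborel (\<lambda>y. ennreal (C * exp (- \<beta> * Q y) * g y))"
    unfolding distributed_distr_eq_density[OF Y, symmetric]
    by (rule prob_space_distr) (use distributed_measurable[OF Y] in simp)
  have total: "(\<integral>\<^sup>+y. ennreal (C * exp (- \<beta> * Q y) * g y) \<partial>lborel) = 1"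
    using Y.emeasure_space_1 h by (subst (asm) emeasure_density) simp_all
  \<comment> \<open>If \<open>C\<close> were not positive, \<open>ennreal\<close> would truncate the
    density of \<open>Y\<close> to 0, against total mass 1. This settles the sign of
    \<open>C\<close> without examining gamma factors or determinants.\<close>
  have C: "0 < C"
  proof (rule ccontr)
    assume "\<not> 0 < C"
    then have "C * exp (- \<beta> * Q y) * g y \<le> 0" for y
      using g0[of y] by (simp add: mult_nonpos_nonneg)
    then show False
      using total by (simp add: ennreal_neg)
  qed
  \<comment> \<open>Absorbing \<open>C\<close> into the weight gives
    \<open>exp (- \<beta> * Q y) * G y\<close> the total mass 1 required by
    \<open>homogeneous_exponential_weight\<close>.\<close>
  define G where "G y = C * g y" for y
  have G0: "0 \<le> G y" for y
    using C g0[of y] by (simp add: G_def)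
  \<comment> \<open>Measurability of the weight is extracted from that of the density by dividing
    out the exponential factor; \<open>enn2real\<close> loses nothing since the density is
    nonnegative.\<close>
  have "G = (\<lambda>y. enn2real (ennreal (C * exp (- \<beta> * Q y) * g y)) * exp (\<beta> * Q y))"
    using C g0 by (auto simp: G_def fun_eq_iff exp_minus)
  also have "\<dots> \<in> borel_measurable borel"
    by measurable
  finally have [measurable]: "G \<in> borel_measurable borel" .
  have g_eq: "g = (\<lambda>y. G y / C)"
    using C by (simp add: G_def)
  have [measurable]: "g \<in> borel_measurable borel"
    unfolding g_eq by measurable
  note weight = homogeneous_exponential_weight[of "\<lambda>y. \<beta> * Q y" G t]
  have AE: "AE y in lborel. g y \<noteq> 0 \<longrightarrow> 0 \<le> Q y" and t: "0 \<le> DIM('b) / 2 + t"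
    using weight total C G0 \<beta> by (simp_all add: G_def Q_hom g_hom zero_le_mult_iff ac_simps)
  have A0: "0 < A"
    using ak t by (simp add: A)
  let ?f = "riesz1_density \<beta> a k \<rho>"
  let ?F = "\<lambda>T. \<integral>\<^sup>+s. ennreal (?f s) * (ennreal (s powr (DIM('b) / 2)) *
    ennreal (C * exp (- \<beta> * Q (sqrt s *\<^sub>R (T - \<mu>))) * g (sqrt s *\<^sub>R (T - \<mu>)))) \<partial>lborel"
  have F: "?F (y + \<mu>) = ennreal (c * (1 + \<rho> * Q y) powr (- A) * g y)"
    if y: "g y \<noteq> 0 \<longrightarrow> 0 \<le> Q y" for y
  proof (cases "g y = 0")
    case True
    have "ennreal (?f s) * (ennreal (s powr (DIM('b) / 2)) *
        ennreal (C * exp (- \<beta> * Q (sqrt s *\<^sub>R y)) * g (sqrt s *\<^sub>R y))) = 0" for s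
      using True by (cases "0 < s") (simp_all add: riesz1_density_def g_hom)
    then show ?thesis
      using True by (simp only: add_diff_cancel_right') simp
  next
    case False
    \<comment> \<open>The rate in \<open>s\<close> after collecting
      \<open>\<beta> * s / \<rho>\<close> from the Riesz density and
      \<open>\<beta> * s * Q y\<close> from the rescaled density of \<open>Y\<close>.\<close>
    define q where "q = \<beta> / \<rho> * (1 + \<rho> * Q y)"
    have Q0: "0 \<le> Q y"
      using y False by blast
    have q: "0 < q"
      using Q0 \<beta> \<rho> by (simp add: q_def add_pos_nonneg)
    define K where "K = \<beta> powr (a + k) / (Gamma (a + k) * \<rho> powr (a + k))"
    have K: "0 < K"
      using \<beta> \<rho> ak by (simp add: K_def Gamma_real_pos)
    have "ennreal (?f s) * (ennreal (s powr (DIM('b) / 2)) *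
        ennreal (C * exp (- \<beta> * Q (sqrt s *\<^sub>R y)) * g (sqrt s *\<^sub>R y)))
      = ennreal (K * C * g y) * ennreal (indicator {0<..} s * (s powr (A - 1) * exp (- q * s)))" for s
    proof (cases "0 < s")
      case True
      have "sqrt s powr (2 * t) = s powr t"
        using True by (simp add: powr_half_sqrt[symmetric] powr_powr)
      moreover have "s powr (A - 1) = s powr (a + k - 1) * s powr (DIM('b) / 2) * s powr t"
        by (simp add: A powr_add[symmetric] algebra_simps)
      moreover have "exp (- q * s) = exp (- \<beta> * s / \<rho>) * exp (- \<beta> * (s * Q y))"
        using \<rho> by (simp add: q_def exp_add[symmetric] field_simps)
      ultimately show ?thesis
        using True K C g0[of y]
        by (simp add: riesz1_density_def Q_hom g_hom ennreal_mult'[symmetric] ennreal_mult''[symmetric] flip: K_def)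
    qed (simp add: riesz1_density_def)
    then have "?F (y + \<mu>) = (\<integral>\<^sup>+s. ennreal (K * C * g y) *
        ennreal (indicator {0<..} s * (s powr (A - 1) * exp (- q * s))) \<partial>lborel)"
      by (simp only: add_diff_cancel_right')
    also have "\<dots> = ennreal (K * C * g y) * ennreal (Gamma A / q powr A)"
      by (subst nn_integral_cmult) (measurable, simp only: nn_integral_powr_exp[OF q A0])
    also have "\<dots> = ennreal (K * C * g y * (Gamma A / q powr A))"
      using K C g0[of y] by (subst ennreal_mult'[of "K * C * g y"]) simp_all
    also have "K * C * g y * (Gamma A / q powr A) = c * (1 + \<rho> * Q y) powr (- A) * g y"
    proof -
      \<comment> \<open>Splitting \<open>A\<close> into \<open>a + k\<close> and
        \<open>DIM('b) / 2 + t\<close> makes the factors \<open>x\<close> and \<open>v\<close> of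
        \<open>K\<close> cancel against those of \<open>q powr A\<close>; the rest is field
        arithmetic.\<close>
      define x u v w z where "x = \<beta> powr (a + k)" and "u = \<beta> powr (DIM('b) / 2 + t)"
        and "v = \<rho> powr (a + k)" and "w = \<rho> powr (DIM('b) / 2 + t)" and "z = (1 + \<rho> * Q y) powr A"
      note defs = this
      have pos: "0 < x" "0 < u" "0 < v" "0 < w"
        using \<beta> \<rho> by (simp_all add: defs)
      have "0 < 1 + \<rho> * Q y"
        using Q0 \<rho> by (simp add: add_pos_nonneg)
      then have z: "0 < z"
        by (simp add: defs)
      have "A = (a + k) + (DIM('b) / 2 + t)"
        by (simp add: A)
      then have "\<beta> powr A = x * u" "\<rho> powr A = v * w"
        by (simp_all only: powr_add defs)
      then have qA: "q powr A = x * u / (v * w) * z"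
        using \<beta> \<rho> by (simp add: q_def powr_mult powr_divide defs(5))
      have "0 < Gamma (a + k)"
        using ak by (rule Gamma_real_pos)
      then show ?thesis
        using pos z unfolding K_def c powr_minus qA defs[symmetric] by (simp add: field_simps)
    qed
    finally show ?thesis .
  qed
  have dist: "distributed M lborel (\<lambda>\<omega>. (1 / sqrt (S \<omega>)) *\<^sub>R Y \<omega> + \<mu>) ?F"
    using S Y indep by (rule distributed_inverse_sqrt_scaling) (simp add: riesz1_density_def)
  \<comment> \<open>Translation invariance of Lebesgue measure carries the exceptional null set from
    \<open>y\<close> to \<open>T - \<mu>\<close>.\<close>
  have "AE y in distr lborel borel ((+) (- \<mu>)). g y \<noteq> 0 \<longrightarrow> 0 \<le> Q y"
    unfolding lborel_distr_plus by (rule AE)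
  then have "AE T in lborel. g (T - \<mu>) \<noteq> 0 \<longrightarrow> 0 \<le> Q (T - \<mu>)"
    by (subst (asm) AE_distr_iff) auto
  then have eq: "AE T in lborel. ?F T = ennreal (c * (1 + \<rho> * Q (T - \<mu>)) powr (- A) * g (T - \<mu>))"
  proof eventually_elim
    fix T assume "g (T - \<mu>) \<noteq> 0 \<longrightarrow> 0 \<le> Q (T - \<mu>)"
    from F[OF this] show "?F T = ennreal (c * (1 + \<rho> * Q (T - \<mu>)) powr (- A) * g (T - \<mu>))"
      by (simp only: diff_add_cancel)
  qed
  have meas: "(\<lambda>T. ennreal (c * (1 + \<rho> * Q (T - \<mu>)) powr (- A) * g (T - \<mu>))) \<in> borel_measurable lborel"
    by measurable
  show ?thesis
    using distributed_cong_density[OF eq meas distributed_borel_measurable[OF dist]] dist by (rule iffD1)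
qed

section \<open>Homogeneity of determinants and generalised powers\<close>

lemma msub_scaleR: "msub I (r *\<^sub>R A) = r *\<^sub>R msub I A"
  by (simp add: msub_def vec_eq_iff)

lemma spectral_resolution_scaleR:
  assumes "spectral_resolution I A c lam"
  shows "spectral_resolution I (r *\<^sub>R A) c (\<lambda>i. r * lam i)"
proof -
  have "(\<Sum>i\<in>I. (r * lam i) *\<^sub>R c i) = r *\<^sub>R (\<Sum>i\<in>I. lam i *\<^sub>R c i)"
    by (simp add: scaleR_sum_right)
  then show ?thesis
    using assms by (simp add: spectral_resolution_def msub_scaleR)
qed

text \<open>Scaling keeps the Jordan frame and multiplies each eigenvalue by \<open>r\<close>. As
  \<open>r\<close> is invertible, the admissible eigenvalue products of the two matrices correspond
  bijectively, so the argument also covers matrices without a spectral resolution.\<close>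

lemma hdet_on_scaleR:
  fixes A :: "'a::hurwitz_algebra^'m^'m"
  assumes r: "r \<noteq> 0"
  shows "hdet_on I (r *\<^sub>R A) = r ^ card I * hdet_on I A"
proof -
  define P where "P B d \<longleftrightarrow> (\<exists>c lam. spectral_resolution I B c lam \<and> d = prod lam I)"
    for B :: "'a^'m^'m" and d
  have scale: "P (s *\<^sub>R B) (s ^ card I * d)" if B: "P B d" for s B d
  proof -
    obtain c lam where "spectral_resolution I B c lam" "d = prod lam I"
      using B by (auto simp: P_def)
    then show ?thesis
      unfolding P_def
      by (intro exI[of _ c] exI[of _ "\<lambda>i. s * lam i"]) (simp add: spectral_resolution_scaleR prod.distrib)
  qed
  have P: "P (r *\<^sub>R A) d \<longleftrightarrow> P A (d / r ^ card I)" for d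
  proof
    assume "P (r *\<^sub>R A) d"
    from scale[OF this, of "inverse r"] show "P A (d / r ^ card I)"
      using r by (simp add: power_inverse divide_inverse mult.commute)
  next
    assume "P A (d / r ^ card I)"
    from scale[OF this, of r] show "P (r *\<^sub>R A) d"
      using r by simp
  qed
  have hdet: "hdet_on I B = (if \<exists>!d. P B d then THE d. P B d else 0)" for B
    by (simp add: hdet_on_def P_def)
  show ?thesis
  proof (cases "\<exists>!d. P A d")
    case True
    then obtain d where d: "\<And>e. P A e \<longleftrightarrow> e = d"
      by blast
    then have "\<And>e. P (r *\<^sub>R A) e \<longleftrightarrow> e = r ^ card I * d"
      using r by (simp add: P field_simps)
    with d have "P A = (\<lambda>e. e = d)" "P (r *\<^sub>R A) = (\<lambda>e. e = r ^ card I * d)"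
      by auto
    then show ?thesis
      by (simp add: hdet)
  next
    case False
    \<comment> \<open>Unique existence would transfer back along this correspondence, so both
      determinants take the default value 0.\<close>
    moreover have "\<not> (\<exists>!d. P (r *\<^sub>R A) d)"
    proof
      assume "\<exists>!d. P (r *\<^sub>R A) d"
      then obtain d where d: "P A (d / r ^ card I)" "\<And>e. P A (e / r ^ card I) \<Longrightarrow> e = d"
        unfolding P by blast
      then have "e = d / r ^ card I" if "P A e" for e
      proof -
        have "r ^ card I * e = d"
          using that r by (intro d(2)) simp
        then show ?thesis
          using r by (simp add: field_simps)
      qed
      with d(1) False show False
        by blast
    qed
    ultimately show ?thesis
      by (simp add: hdet)
  qed
qed

text \<open>The position is strictly increasing in the index, hence injective, and counting gives
  surjectivity.\<close>

lemma bij_betw_card_atMost: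
  "bij_betw (\<lambda>i. card {..i}) (UNIV :: 'm::{finite,linorder} set) {1..CARD('m)}"
proof -
  have "strict_mono (\<lambda>i::'m. card {..i})"
    by (intro strict_monoI psubset_card_mono) (auto simp: less_le_not_le)
  then have inj: "inj (\<lambda>i::'m. card {..i})"
    by (rule strict_mono_imp_inj_on)
  have "range (\<lambda>i::'m. card {..i}) \<subseteq> {1..CARD('m)}"
    by (auto simp: Suc_le_eq card_gt_0_iff intro!: card_mono)
  then have "range (\<lambda>i::'m. card {..i}) = {1..CARD('m)}"
    using inj by (intro card_subset_eq) (simp_all add: card_image)
  with inj show ?thesis
    by (simp add: bij_betw_def)
qed

text \<open>This identifies the index set in \<open>lead_minor p\<close> as one of size
  \<open>p\<close>, which fixes the degree of the minor.\<close>

lemma card_leading_indices: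
  assumes "p \<le> CARD('m)"
  shows "card {i :: 'm::{finite,linorder}. card {..i} \<le> p} = p"
proof -
  have inj: "inj (\<lambda>i::'m. card {..i})" and range: "range (\<lambda>i::'m. card {..i}) = {1..CARD('m)}"
    using bij_betw_card_atMost[where 'm='m] by (simp_all add: bij_betw_def)
  have "(\<lambda>i::'m. card {..i}) ` {i. card {..i} \<le> p} = range (\<lambda>i::'m. card {..i}) \<inter> {..p}"
    by auto
  also have "\<dots> = {1..p}"
    unfolding range using assms by auto
  finally have "card ((\<lambda>i::'m. card {..i}) ` {i. card {..i} \<le> p}) = p"
    by simp
  then show ?thesis
    using card_image[OF inj_on_subset[OF inj subset_UNIV], of "{i. card {..i} \<le> p}"] by simp
qed

lemma lead_minor_scaleR:
  fixes A :: "'a::hurwitz_algebra^'m::{finite,linorder}^'m::{finite,linorder}"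
  assumes "r \<noteq> 0" "p \<le> CARD('m)"
  shows "lead_minor p (r *\<^sub>R A) = r ^ p * lead_minor p A"
  using assms by (simp add: lead_minor_def hdet_on_scaleR card_leading_indices)

text \<open>Summation by parts: the left side is the total degree of the generalised power, as the
  \<open>i\<close>-th leading minor has degree \<open>i\<close>.\<close>

lemma sum_weight_differences:
  assumes "1 \<le> (m::nat)"
  shows "real m * \<kappa> m + (\<Sum>i = 1..<m. real i * (\<kappa> i - \<kappa> (i + 1))) = (\<Sum>i = 1..m. \<kappa> i :: real)"
  using assms by (induction m rule: dec_induct) (simp_all add: algebra_simps)

lemma gen_power_scaleR:
  fixes A :: "'a::hurwitz_algebra^'m::{finite,linorder}^'m::{finite,linorder}"
  assumes r: "0 < r"
  shows "gen_power \<kappa> (r *\<^sub>R A) = r powr (\<Sum>i = 1..CARD('m). \<kappa> i) * gen_power \<kappa> A"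
proof -
  let ?m = "CARD('m)"
  have powr: "lead_minor p (r *\<^sub>R A) powr x = r powr (real p * x) * lead_minor p A powr x"
    if "p \<le> ?m" for p x
    using r that by (simp add: lead_minor_scaleR powr_mult powr_powr powr_realpow[symmetric])
  have "(\<Prod>i = 1..<?m. lead_minor i (r *\<^sub>R A) powr (\<kappa> i - \<kappa> (i + 1)))
      = (\<Prod>i = 1..<?m. r powr (real i * (\<kappa> i - \<kappa> (i + 1))) * lead_minor i A powr (\<kappa> i - \<kappa> (i + 1)))"
    by (intro prod.cong) (simp_all add: powr)
  also have "\<dots> = r powr (\<Sum>i = 1..<?m. real i * (\<kappa> i - \<kappa> (i + 1))) *
      (\<Prod>i = 1..<?m. lead_minor i A powr (\<kappa> i - \<kappa> (i + 1)))"
    using r by (simp add: prod.distrib powr_sum)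
  finally have "gen_power \<kappa> (r *\<^sub>R A) =
      r powr (real ?m * \<kappa> ?m + (\<Sum>i = 1..<?m. real i * (\<kappa> i - \<kappa> (i + 1)))) * gen_power \<kappa> A"
    using powr[of ?m] by (simp add: gen_power_def powr_add)
  then show ?thesis
    by (subst (asm) sum_weight_differences) (simp_all add: Suc_le_eq)
qed

text \<open>Each factor is a \<open>powr\<close>, which is nonnegative whatever the sign of the
  minor.\<close>

lemma gen_power_nonneg: "0 \<le> gen_power \<kappa> A"
  by (simp add: gen_power_def prod_nonneg)

section \<open>Scaling and continuity of the trace form\<close>

lemma madj_scaleR: "madj (r *\<^sub>R A) = r *\<^sub>R madj A"
  by (simp add: madj_def vec_eq_iff hcnj_scaleR)

lemma mcong_scaleR_left: "mcong (r *\<^sub>R P) W = r\<^sup>2 *\<^sub>R mcong P W"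
  by (simp add: mcong_def madj_scaleR mmul_scaleR_left mmul_scaleR_right power2_eq_square algebra_simps)

lemma mcong_scaleR_right: "mcong P (r *\<^sub>R W) = r *\<^sub>R mcong P W"
  by (simp add: mcong_def mmul_scaleR_left mmul_scaleR_right algebra_simps)

lemma rtr_scaleR: "rtr (r *\<^sub>R A) = r * rtr A"
  by (simp add: rtr_def hRe_def sum_distrib_left)

lemma bilinear_hz_mult: "bilinear ((*) :: 'a::hurwitz_algebra \<Rightarrow> 'a \<Rightarrow> 'a)"
  by (simp add: bilinear_def linear_iff hz_add_left hz_add_right hz_scaleR_left hz_scaleR_right)

text \<open>A bilinear map on finite-dimensional spaces is bounded, hence continuous.\<close>

lemma continuous_on_hz_mult:
  fixes f g :: "'x::topological_space \<Rightarrow> 'a::hurwitz_algebra"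
  assumes "continuous_on A f" "continuous_on A g"
  shows "continuous_on A (\<lambda>x. f x * g x)"
  by (rule bounded_bilinear.continuous_on[OF bilinear_hz_mult[unfolded bilinear_conv_bounded_bilinear] assms])

lemma continuous_on_mmul:
  assumes "continuous_on A f" "continuous_on A g"
  shows "continuous_on A (\<lambda>x. f x \<odot> g x)"
  unfolding mmul_def using assms by (intro continuous_intros continuous_on_hz_mult) auto

lemma continuous_on_madj:
  assumes "continuous_on A f"
  shows "continuous_on A (\<lambda>x. madj (f x))"
  unfolding madj_def hcnj_def using assms by (intro continuous_intros)

lemma continuous_on_rtr:
  assumes "continuous_on A f"
  shows "continuous_on A (\<lambda>x. rtr (f x))"
  unfolding rtr_def hRe_def using assms by (intro continuous_intros)

text \<open>Supplies the measurability of \<open>Q\<close>: the inverses are constants here, and the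
  entries of \<open>y\<close> enter polynomially.\<close>

lemma continuous_on_rtr_mcong: "continuous_on A (\<lambda>y. rtr (B \<odot> mcong y W))"
  unfolding mcong_def by (intro continuous_intros continuous_on_rtr continuous_on_mmul continuous_on_madj)

section \<open>The matrix multivariate T-Riesz law\<close>

theorem theorem3p1:
  fixes M :: "'w measure"
    and S :: "'w \<Rightarrow> real"
    and Y :: "'w \<Rightarrow> 'a::hurwitz_algebra^'m::{finite,linorder}^'n"
    and \<mu> :: "'a^'m::{finite,linorder}^'n"
    and \<Theta> :: "'a^'n^'n"
    and \<Sigma> :: "'a^'m::{finite,linorder}^'m::{finite,linorder}"
    and \<tau> :: "nat \<Rightarrow> real"
    and \<rho> k \<nu> \<beta> c :: real
    and m n :: nat
  assumes \<beta>: "\<beta> = real DIM('a)"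
    and m: "m = CARD('m)"
    and n: "n = CARD('n)"
    and mn: "m \<le> n"
    and \<rho>: "0 < \<rho>"
    and \<nu>: "\<nu> * \<beta> / 2 > - k"
    and \<tau>: "real n * \<beta> / 2 > (real m - 1) * \<beta> / 2 - \<tau> m"
    and \<Sigma>: "pos_def \<Sigma>"
    and \<Theta>: "pos_def \<Theta>"
    and \<mu>: "full_rank_distinct_sv \<mu>"
    and M: "prob_space M"
    and S: "distributed M lborel S (\<lambda>s. ennreal (riesz1_density \<beta> (\<nu> * \<beta> / 2) k \<rho> s))"
    and Y: "distributed M lborel Y (\<lambda>y. ennreal (kotz_riesz1_density \<tau> 0 \<Theta> \<Sigma> y))"
    and indep: "prob_space.indep_set M {S -` A \<inter> space M | A. A \<in> sets borel}
      {Y -` B \<inter> space M | B. B \<in> sets borel}"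
    and c: "c =
      mgamma m \<beta> (n * \<beta> / 2) * mgamma 1 \<beta> ((\<nu> + m * n) * \<beta> / 2 + k + (\<Sum>i = 1..m. \<tau> i)) *
      \<rho> powr (\<beta> * m * n / 2 + (\<Sum>i = 1..m. \<tau> i)) /
      (pi powr (\<beta> * m * n / 2) * mgamma_wt m \<beta> (n * \<beta> / 2) \<tau> * mgamma 1 \<beta> (\<nu> * \<beta> / 2 + k) *
       hdet \<Sigma> powr (\<beta> * n / 2) * hdet \<Theta> powr (\<beta> * m / 2))"
  shows "distributed M lborel (\<lambda>\<omega>. (1 / sqrt (S \<omega>)) *\<^sub>R Y \<omega> + \<mu>)
    (\<lambda>T. ennreal (
      c * (1 + \<rho> * rtr (hinv \<Sigma> \<odot> mcong (T - \<mu>) (hinv \<Theta>)))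
            powr (- ((\<nu> + m * n) * \<beta> / 2 + k + (\<Sum>i = 1..m. \<tau> i))) *
      gen_power \<tau> (mcong (minv (chol \<Sigma>)) (mcong (T - \<mu>) (hinv \<Theta>)))))"
proof -
  interpret prob_space M by fact
  let ?t = "\<Sum>i = 1..m. \<tau> i"
  define Q :: "'a^'m::{finite,linorder}^'n \<Rightarrow> real" where "Q y = rtr (hinv \<Sigma> \<odot> mcong y (hinv \<Theta>))" for y
  define g :: "'a^'m::{finite,linorder}^'n \<Rightarrow> real"
    where "g y = gen_power \<tau> (mcong (minv (chol \<Sigma>)) (mcong y (hinv \<Theta>)))" for y
  \<comment> \<open>The normalising constant of the Kotz-Riesz density of \<open>Y\<close>.\<close>
  define C where "C = \<beta> powr (m * n * \<beta> / 2 + ?t) * mgamma m \<beta> (n * \<beta> / 2) /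
    (pi powr (m * n * \<beta> / 2) * mgamma_wt m \<beta> (n * \<beta> / 2) \<tau> *
     hdet \<Sigma> powr (n * \<beta> / 2) * hdet \<Theta> powr (m * \<beta> / 2))"
  define A where "A = (\<nu> + m * n) * \<beta> / 2 + k + ?t"
  have dim: "real DIM('a^'m::{finite,linorder}^'n) / 2 = m * n * \<beta> / 2"
    by (simp add: m n \<beta>)
  have \<beta>0: "0 < \<beta>"
    by (simp add: \<beta>)
  have mgamma_1: "mgamma 1 \<beta> x = Gamma x" for x
    by (simp add: mgamma_def)
  have "distributed M lborel (\<lambda>\<omega>. (1 / sqrt (S \<omega>)) *\<^sub>R Y \<omega> + \<mu>)
    (\<lambda>T. ennreal (c * (1 + \<rho> * Q (T - \<mu>)) powr (- A) * g (T - \<mu>)))"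
  proof (rule distributed_T_riesz1[where C = C and t = ?t, OF \<beta>0 \<rho> _ _ _ _ _ S _ indep])
    show "0 < \<nu> * \<beta> / 2 + k"
      using \<nu> by simp
    show "Q \<in> borel_measurable borel"
      unfolding Q_def by (intro borel_measurable_continuous_onI continuous_on_rtr_mcong)
    show "0 \<le> g y" for y
      by (simp add: g_def gen_power_nonneg)
    show "Q (r *\<^sub>R y) = r\<^sup>2 * Q y" for r y
      by (simp add: Q_def mcong_scaleR_left mmul_scaleR_right rtr_scaleR)
    show "g (r *\<^sub>R y) = r powr (2 * ?t) * g y" if "0 < r" for r y
    proof -
      \<comment> \<open>The inner congruence is quadratic in \<open>y\<close> and the outer one is
        linear in its second argument, so the generalised power sees the factor
        \<open>r\<^sup>2\<close>.\<close>
      have "g (r *\<^sub>R y) = (r\<^sup>2) powr ?t * g y"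
        using that by (simp add: g_def mcong_scaleR_left mcong_scaleR_right gen_power_scaleR m)
      then show ?thesis
        using that by (simp add: powr_powr flip: powr_numeral)
    qed
    show "distributed M lborel Y (\<lambda>y. ennreal (C * exp (- \<beta> * Q y) * g y))"
      using Y by (simp add: kotz_riesz1_density_def Let_def C_def Q_def g_def m n \<beta>)
    show "A = \<nu> * \<beta> / 2 + k + real DIM('a^'m::{finite,linorder}^'n) / 2 + ?t"
      unfolding dim by (simp add: A_def algebra_simps add_divide_distrib)
    \<comment> \<open>The power of \<open>\<beta>\<close> contained in \<open>C\<close> is exactly
      the one divided out.\<close>
    show "c = C * Gamma A * \<rho> powr (real DIM('a^'m::{finite,linorder}^'n) / 2 + ?t) /
        (\<beta> powr (real DIM('a^'m::{finite,linorder}^'n) / 2 + ?t) * Gamma (\<nu> * \<beta> / 2 + k))"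
      unfolding dim c mgamma_1 using \<beta>0 by (simp add: C_def A_def ac_simps)
  qed
  then show ?thesis
    by (simp add: Q_def g_def A_def)
qed

end
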